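(* Let $\mathcal{D}=\{D_t,\ t\in[0,T]\}$ be a family of sets such that $D_t\in\mathcal{C}$ for every $t\in[0,T]$, $t\mapsto D_t$ is càdlàg with respect to the Hausdorff metric, and $D_T=D_{T^-}$. Let $y$ and $a$ be elements of $\mathbb{D}([0,T],\mathbb{R}^d)$ such that $y_0\in D_0$, $a\in\mathring{\mathcal{D}}$, and $\inf_{t\in[0,T]}d(a_t,\partial D_t)>0$. Then there exists a unique solution $(x,k)$ of the reflection problem $RP_{\mathcal{D}}(y)$. In addition, there exists a constant $C>0$ such that $$|k|_{T}\leq C\Big(\sup_{s\in[0,T]}|y_s|^2+\sup_{s\in[0,T]}|a_s|^2+1\Big).$$
   Context: Fix $T>0$ and $d\ge 1$; $|\cdot|$ and $\langle\cdot,\cdot\rangle$ denote the Euclidean norm and inner product on $\mathbb{R}^d$. $\mathcal{C}$ is the set of all bounded closed convex subsets of $\mathbb{R}^d$ with nonempty interior, endowed with the Hausdorff metric $d_H(D,D')=\max(\sup_{x\in D}d(x,D'),\sup_{x\in D'}d(x,D))$, where $d(x,D)=\inf_{y\in D}|x-y|$. "Càdlàg" means right-continuous with left limits; $t\mapsto D_t$ is càdlàg with respect to the Hausdorff metric if it is càdlàg as a map into $(\mathcal{C},d_H)$, and $D_{T^-}$ is its left limit at $T$. $\partial D$ and $\mathring{D}$ are the boundary and interior of $D$. $\mathbb{D}([0,T],\mathbb{R}^{d})$ is the space of càdlàg maps $y:[0,T]\to\mathbb{R}^d$ with $y_T=y_{T^-}$. One writes $z\in\mathcal{D}$ if $z_t\in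 D_t$ for every $t\in[0,T]$, and $z\in\mathring{\mathcal{D}}$ if $z_t\in\mathring{D}_t$ for every $t\in[0,T]$. For a function $k$ of finite variation, $|k|_t$ is its total variation on $[0,t]$. Reflection problem $RP_{\mathcal{D}}(y)$: for $y\in\mathbb{D}([0,T],\mathbb{R}^d)$ with $y_0\in D_0$, a pair $(x,k)$ of elements of $\mathbb{D}([0,T],\mathbb{R}^{d})$, with $k$ of finite variation and $k_0=0$, is a solution if (i) $x_t=y_t+k_t$ for every $t\in[0,T]$; (ii) $x\in\mathcal{D}$; (iii) for every càdlàg $z$ with $z\in\mathcal{D}$ and every $t\in[0,T]$, $\int_0^t\langle x_s-z_s,\mathrm{d}k_s\rangle\le 0$ (Lebesgue–Stieltjes integral over $(0,t]$). *)

theory Defs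
  imports "HOL-Analysis.Analysis"
begin

text \<open>Functions on $[0,T]$ are represented by functions on \<^typ>\<open>real\<close>; all notions below depend
  only on their values on \<^term>\<open>{0..T}\<close>.\<close>

definition cadlag_on :: "real \<Rightarrow> (real \<Rightarrow> 'a::topological_space) \<Rightarrow> bool" where
  "cadlag_on T f \<longleftrightarrow>
     (\<forall>t\<in>{0..<T}. (f \<longlongrightarrow> f t) (at_right t)) \<and>
     (\<forall>t\<in>{0<..T}. \<exists>l. (f \<longlongrightarrow> l) (at_left t))"

definition cadlag_space :: "real \<Rightarrow> (real \<Rightarrow> 'a::topological_space) set" where
  "cadlag_space T = {f. cadlag_on T f \<and> (f \<longlongrightarrow> f T) (at_left T)}"

definition convex_bodies :: "'a::real_normed_vector set set" where
  "convex_bodies = {A. bounded A \<and> closed A \<and> convex A \<and> interior A \<noteq> {}}"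

text \<open>The suprema are taken in \<^typ>\<open>real\<close>; they are genuine for nonempty bounded sets, the only
  ones to which the distance is applied.\<close>

definition hausdorff_dist :: "'a::metric_space set \<Rightarrow> 'a set \<Rightarrow> real" where
  "hausdorff_dist A B = max (SUP x\<in>A. infdist x B) (SUP x\<in>B. infdist x A)"

definition hausdorff_tendsto ::
    "('b \<Rightarrow> 'a::metric_space set) \<Rightarrow> 'a set \<Rightarrow> 'b filter \<Rightarrow> bool" where
  "hausdorff_tendsto D A F \<longleftrightarrow> ((\<lambda>s. hausdorff_dist (D s) A) \<longlongrightarrow> 0) F"

text \<open>Left limits are required to lie in \<^const>\<open>convex_bodies\<close> again.\<close>

definition cadlag_bodies :: "real \<Rightarrow> (real \<Rightarrow> 'a::real_normed_vector set) \<Rightarrow> bool" where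
  "cadlag_bodies T D \<longleftrightarrow>
     (\<forall>t\<in>{0..T}. D t \<in> convex_bodies) \<and>
     (\<forall>t\<in>{0..<T}. hausdorff_tendsto D (D t) (at_right t)) \<and>
     (\<forall>t\<in>{0<..T}. \<exists>L\<in>convex_bodies. hausdorff_tendsto D L (at_left t))"

definition variation_sums :: "(real \<Rightarrow> 'a::real_normed_vector) \<Rightarrow> real \<Rightarrow> real set" where
  "variation_sums k t =
     {\<Sum>i<n. norm (k (p (Suc i)) - k (p i)) | (p :: nat \<Rightarrow> real) n.
        p 0 = 0 \<and> p n = t \<and> (\<forall>i<n. p i \<le> p (Suc i))}"

definition finite_variation :: "real \<Rightarrow> (real \<Rightarrow> 'a::real_normed_vector) \<Rightarrow> bool" where
  "finite_variation T k \<longleftrightarrow> bdd_above (variation_sums k T)"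

definition total_variation :: "(real \<Rightarrow> 'a::real_normed_vector) \<Rightarrow> real \<Rightarrow> real" where
  "total_variation k t = Sup (variation_sums k t)"

text \<open>Lebesgue--Stieltjes integral of \<open>f\<close> over $(0,t]$ against a right-continuous \<open>g\<close> of finite
  variation. It is the difference of the integrals against the two nondecreasing functions in
  the decomposition $g = |g| - (|g| - g)$, which are extended to the real line as constants to the
  left of 0 and to the right of \<open>t\<close>.\<close>

definition LS_integral :: "real \<Rightarrow> (real \<Rightarrow> real) \<Rightarrow> (real \<Rightarrow> real) \<Rightarrow> real" where
  "LS_integral t f g =
     (LINT s:{0<..t}|interval_measure (\<lambda>s. total_variation g (max 0 (min s t))). f s) -
     (LINT s:{0<..t}|interval_measure
        (\<lambda>s. total_variation g (max 0 (min s t)) - g (max 0 (min s t))). f s)"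

definition LS_inner_integral ::
    "real \<Rightarrow> (real \<Rightarrow> 'a::euclidean_space) \<Rightarrow> (real \<Rightarrow> 'a) \<Rightarrow> real" where
  "LS_inner_integral t f k = (\<Sum>b\<in>Basis. LS_integral t (\<lambda>s. f s \<bullet> b) (\<lambda>s. k s \<bullet> b))"

definition reflection_solution ::
    "real \<Rightarrow> (real \<Rightarrow> 'a::euclidean_space set) \<Rightarrow> (real \<Rightarrow> 'a) \<Rightarrow>
     (real \<Rightarrow> 'a) \<Rightarrow> (real \<Rightarrow> 'a) \<Rightarrow> bool" where
  "reflection_solution T D y x k \<longleftrightarrow>
     x \<in> cadlag_space T \<and> k \<in> cadlag_space T \<and> finite_variation T k \<and> k 0 = 0 \<and>
     (\<forall>t\<in>{0..T}. x t = y t + k t) \<and>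
     (\<forall>t\<in>{0..T}. x t \<in> D t) \<and>
     (\<forall>z. cadlag_on T z \<and> (\<forall>t\<in>{0..T}. z t \<in> D t) \<longrightarrow>
        (\<forall>t\<in>{0..T}. LS_inner_integral t (\<lambda>s. x s - z s) k \<le> 0))"

end

theory Submission
  imports Defs
begin

text \<open>Solutions are limits of the discrete schemes that project the increments of \<open>y\<close> onto
  \<open>D\<close> at finitely many times, chosen such that \<open>y\<close> and \<open>D\<close> oscillate little in
  between. Since a ball of fixed radius \<open>r\<close> around \<open>a\<close> lies in \<open>D\<close>, the jumps of a scheme
  satisfy $r |\Delta k| \le \langle a - y - k, \Delta k\rangle$; approximating $a - y$ by a step
  function and summing by parts bounds the variation of \<open>k\<close> uniformly over all schemes. The
  inequality $\frac12 |u_t|^2 \le \sum \langle u, \Delta u\rangle$ for the difference \<open>u\<close> of two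
  schemes then shows that they converge uniformly, and for the difference of two solutions
  it gives uniqueness. The Stieltjes integrals are handled as limits of right-endpoint
  Riemann sums.\<close>

subsection \<open>Pure jump functions and adapted partitions\<close>

text \<open>The variation bound must not depend on the number of projections. Bounding
  \<open>a - y\<close> by its supremum is not enough: that may exceed \<open>r\<close>, and the term
  would swamp r |k|. With a step function at distance \<open>r / 2\<close>, half of r |k| absorbs
  the error, and the step part sees only the supremum of \<open>k\<close> instead of its variation;
  the quadratic term hidden in the pairing of \<open>k\<close> with its own increments controls that
  supremum. The same exchange carries the passage to the limit: uniform closeness of
  \<open>k\<close> to a scheme does not make their difference small in variation, but against a step
  integrand it suffices, and for the remaining error the common variation bound is enough. As
  \<open>k\<close> jumps, there is no exact chain rule for |u|^2, only an inequality. Its sign is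
  the useful one because every pairing takes the value after the jump, which is also the value that
  the integral over (0,t] takes.\<close>

definition jump_fun :: "real set \<Rightarrow> (real \<Rightarrow> 'a::comm_monoid_add) \<Rightarrow> real \<Rightarrow> 'a" where
  "jump_fun A d t = sum d (A \<inter> {..t})"

lemma jump_fun_diff:
  fixes d :: "real \<Rightarrow> 'a::ab_group_add"
  assumes "finite A" "s \<le> t"
  shows "jump_fun A d t - jump_fun A d s = sum d (A \<inter> {s<..t})"
proof -
  have "A \<inter> {..t} = (A \<inter> {..s}) \<union> (A \<inter> {s<..t})" using assms by auto
  moreover have "sum d ((A \<inter> {..s}) \<union> (A \<inter> {s<..t})) = sum d (A \<inter> {..s}) + sum d (A \<inter> {s<..t})"
    using assms by (intro sum.union_disjoint) auto
  ultimately show ?thesis by (simp add: jump_fun_def)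
qed

lemma jump_fun_eq:
  fixes d :: "real \<Rightarrow> 'a::ab_group_add"
  assumes "finite A" "s \<le> t" "A \<inter> {s<..t} = {}"
  shows "jump_fun A d t = jump_fun A d s"
  using jump_fun_diff[OF assms(1,2), of d] assms(3) by simp

lemma norm_jump_fun_diff_le:
  fixes d :: "real \<Rightarrow> 'a::real_normed_vector"
  assumes "finite A" "s \<le> t"
  shows "norm (jump_fun A d t - jump_fun A d s) \<le>
    jump_fun A (\<lambda>s. norm (d s)) t - jump_fun A (\<lambda>s. norm (d s)) s"
  unfolding jump_fun_diff[OF assms] by (rule norm_sum)

lemma finite_gap_right:
  fixes A :: "real set" assumes "finite A"
  obtains u where "u > t" "A \<inter> {t<..<u} = {}"
proof (cases "A \<inter> {t<..} = {}")
  case True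
  show ?thesis by (rule that[of "t + 1"]) (use True in auto)
next
  case False
  have f: "finite (A \<inter> {t<..})" using assms by auto
  show ?thesis
    by (rule that[of "Min (A \<inter> {t<..})"])
      (use f False Min_in[OF f False] Min_le[OF f] in fastforce)+
qed

lemma finite_gap_left:
  fixes A :: "real set" assumes "finite A"
  obtains u where "u < t" "A \<inter> {u<..<t} = {}"
proof (cases "A \<inter> {..<t} = {}")
  case True
  show ?thesis by (rule that[of "t - 1"]) (use True in auto)
next
  case False
  have f: "finite (A \<inter> {..<t})" using assms by auto
  show ?thesis
    by (rule that[of "Max (A \<inter> {..<t})"])
      (use f False Max_in[OF f False] Max_ge[OF f] in fastforce)+
qed

lemma tendsto_jump_fun_right:
  fixes d :: "real \<Rightarrow> 'a::real_normed_vector"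
  assumes "finite A"
  shows "(jump_fun A d \<longlongrightarrow> jump_fun A d t) (at_right t)"
proof -
  obtain u where u: "u > t" "A \<inter> {t<..<u} = {}" using finite_gap_right[OF assms] .
  have "\<forall>\<^sub>F s in at_right t. jump_fun A d s = jump_fun A d t"
    using u(1) unfolding eventually_at_right[OF u(1)]
    by (intro exI[of _ u]) (use u assms in \<open>auto intro!: jump_fun_eq\<close>)
  then show ?thesis by (simp add: tendsto_eventually)
qed

lemma tendsto_jump_fun_left:
  fixes d :: "real \<Rightarrow> 'a::real_normed_vector"
  assumes "finite A"
  obtains l where "(jump_fun A d \<longlongrightarrow> l) (at_left t)"
proof -
  obtain u where u: "u < t" "A \<inter> {u<..<t} = {}" using finite_gap_left[OF assms] .
  have "\<forall>\<^sub>F s in at_left t. jump_fun A d s = jump_fun A d u"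
    unfolding eventually_at_left[OF u(1)]
    by (intro exI[of _ u]) (use u assms in \<open>auto intro!: jump_fun_eq\<close>)
  then show ?thesis by (rule that[OF tendsto_eventually])
qed

text \<open>Discrete chain rule: appending a last term \<open>d b\<close> to a sum u changes half of
  its squared norm by the pairing of u + d b with d b, minus |d b|^2 / 2. The partial sums include
  the current term, which gives the discarded square its favourable sign.\<close>

lemma norm_sum_sq_le_inner_partial_sums:
  fixes d :: "real \<Rightarrow> 'a::real_inner"
  assumes "finite B"
  shows "(norm (sum d B))\<^sup>2 / 2 \<le> (\<Sum>s\<in>B. sum d (B \<inter> {..s}) \<bullet> d s)"
  using assms
proof (induction B rule: finite_linorder_max_induct)
  case (insert b A)
  have b: "b \<notin> A" using insert by auto
  have "(\<Sum>s\<in>insert b A. sum d (insert b A \<inter> {..s}) \<bullet> d s) =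
      sum d (insert b A \<inter> {..b}) \<bullet> d b + (\<Sum>s\<in>A. sum d (insert b A \<inter> {..s}) \<bullet> d s)"
    using insert b by simp
  also have "insert b A \<inter> {..b} = insert b A" using insert by auto
  also have "(\<Sum>s\<in>A. sum d (insert b A \<inter> {..s}) \<bullet> d s) = (\<Sum>s\<in>A. sum d (A \<inter> {..s}) \<bullet> d s)"
    using insert by (intro sum.cong refl arg_cong2[where f = inner] sum.cong) auto
  finally have "(\<Sum>s\<in>insert b A. sum d (insert b A \<inter> {..s}) \<bullet> d s) \<ge>
      (d b + sum d A) \<bullet> d b + (norm (sum d A))\<^sup>2 / 2" using insert b by simp
  moreover have "(norm (sum d (insert b A)))\<^sup>2 / 2 \<le> (d b + sum d A) \<bullet> d b + (norm (sum d A))\<^sup>2 / 2"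
    using insert b by (simp add: power2_norm_eq_inner algebra_simps inner_commute)
  ultimately show ?case by linarith
qed simp

lemma norm_jump_fun_sq_le:
  fixes d :: "real \<Rightarrow> 'a::real_inner"
  assumes "finite A"
  shows "(norm (jump_fun A d t))\<^sup>2 / 2 \<le> (\<Sum>s\<in>A \<inter> {..t}. jump_fun A d s \<bullet> d s)"
proof -
  have "(\<Sum>s\<in>A \<inter> {..t}. sum d (A \<inter> {..t} \<inter> {..s}) \<bullet> d s) = (\<Sum>s\<in>A \<inter> {..t}. sum d (A \<inter> {..s}) \<bullet> d s)"
    by (intro sum.cong refl arg_cong2[where f = inner] sum.cong) auto
  then show ?thesis
    using norm_sum_sq_le_inner_partial_sums[of "A \<inter> {..t}" d] assms by (simp add: jump_fun_def)
qed

text \<open>Summation by parts: the weights \<open>jump_fun B \<gamma>\<close> have variation at most the sum of the jumps.\<close>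

lemma sum_jump_fun_inner_le:
  fixes \<gamma> :: "real \<Rightarrow> 'a::real_inner"
  assumes "finite B" "finite I" and K: "\<And>b. norm (\<Sum>i\<in>{i\<in>I. b \<le> q i}. d i) \<le> K"
  shows "\<bar>\<Sum>i\<in>I. jump_fun B \<gamma> (q i) \<bullet> d i\<bar> \<le> K * (\<Sum>b\<in>B. norm (\<gamma> b))"
proof -
  have "(\<Sum>i\<in>I. jump_fun B \<gamma> (q i) \<bullet> d i) = (\<Sum>i\<in>I. \<Sum>b\<in>B. if b \<le> q i then \<gamma> b \<bullet> d i else 0)"
    unfolding jump_fun_def inner_sum_left
    using assms(1) by (rule_tac sum.cong[OF refl]) (simp add: sum.inter_restrict)
  also have "\<dots> = (\<Sum>b\<in>B. \<Sum>i\<in>I. if b \<le> q i then \<gamma> b \<bullet> d i else 0)" by (rule sum.swap)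
  also have "\<dots> = (\<Sum>b\<in>B. \<gamma> b \<bullet> (\<Sum>i\<in>{i\<in>I. b \<le> q i}. d i))"
    using assms(2) by (simp add: inner_sum_right sum.inter_filter if_distrib[where f = "inner _"] cong: if_cong)
  finally have "\<bar>\<Sum>i\<in>I. jump_fun B \<gamma> (q i) \<bullet> d i\<bar> \<le> (\<Sum>b\<in>B. \<bar>\<gamma> b \<bullet> (\<Sum>i\<in>{i\<in>I. b \<le> q i}. d i)\<bar>)"
    by (simp add: sum_abs)
  also have "\<dots> \<le> (\<Sum>b\<in>B. norm (\<gamma> b) * K)"
    by (intro sum_mono order_trans[OF Cauchy_Schwarz_ineq2] mult_left_mono K) auto
  finally show ?thesis by (simp add: sum_distrib_left mult.commute)
qed

text \<open>Compactness by bisection: it suffices to treat short intervals around each point. The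
  oscillation \<open>\<rho>\<close> is abstract so that it can measure a function alone or a
  function together with a moving set. The empty intersection makes \<open>s\<close> the last time
  of \<open>A\<close> up to \<open>t\<close>.\<close>

lemma cadlag_partition:
  fixes \<rho> :: "real \<Rightarrow> real \<Rightarrow> real"
  assumes "T > 0" "e > 0"
    and refl: "\<And>t. t \<in> {0..T} \<Longrightarrow> \<rho> t t = 0"
    and right: "\<And>t. t \<in> {0..<T} \<Longrightarrow> (\<rho> t \<longlongrightarrow> 0) (at_right t)"
    and left: "\<And>t e. t \<in> {0<..T} \<Longrightarrow> e > 0 \<Longrightarrow> \<exists>u<t. \<forall>s\<in>{u<..<t}. \<forall>s'\<in>{u<..<t}. 0 \<le> s \<longrightarrow> s \<le> s' \<longrightarrow> \<rho> s s' \<le> e"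
  shows "\<exists>A. finite A \<and> A \<subseteq> {0..<T} \<and>
    (\<forall>t\<in>{0..<T}. \<exists>s\<in>A. s \<le> t \<and> A \<inter> {s<..t} = {} \<and> \<rho> s t \<le> e)"
proof -
  \<comment> \<open>The guards are there because the local condition of \<open>Bolzano\<close>
    ranges over all short intervals around a point, also over those that stick out of [0,T].\<close>
  define P where "P a b \<longleftrightarrow> (0 \<le> a \<longrightarrow> b \<le> T \<longrightarrow> (\<exists>A. finite A \<and> A \<subseteq> {a..<b} \<and>
    (\<forall>t\<in>{a..<b}. \<exists>s\<in>A. s \<le> t \<and> A \<inter> {s<..t} = {} \<and> \<rho> s t \<le> e)))" for a b :: real
  have "P 0 T"
  proof (rule Bolzano)
    show "0 \<le> T" using assms by simp
  next
    fix a b c assume ab: "P a b" and bc: "P b c" and le: "a \<le> b" "b \<le> c"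
    show "P a c" unfolding P_def
    proof (intro impI)
      assume "0 \<le> a" "c \<le> T"
      with ab le obtain A where A: "finite A" "A \<subseteq> {a..<b}"
        "\<forall>t\<in>{a..<b}. \<exists>s\<in>A. s \<le> t \<and> A \<inter> {s<..t} = {} \<and> \<rho> s t \<le> e" unfolding P_def by fastforce
      from \<open>0 \<le> a\<close> \<open>c \<le> T\<close> bc le obtain B where B: "finite B" "B \<subseteq> {b..<c}"
        "\<forall>t\<in>{b..<c}. \<exists>s\<in>B. s \<le> t \<and> B \<inter> {s<..t} = {} \<and> \<rho> s t \<le> e" unfolding P_def by fastforce
      have "\<exists>s\<in>A \<union> B. s \<le> t \<and> (A \<union> B) \<inter> {s<..t} = {} \<and> \<rho> s t \<le> e" if t: "t \<in> {a..<c}" for t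
      proof (cases "t < b")
        case True
        then obtain s where "s\<in>A" "s \<le> t" "A \<inter> {s<..t} = {}" "\<rho> s t \<le> e" using A(3) t by force
        moreover have "B \<inter> {s<..t} = {}" using B(2) True by fastforce
        ultimately show ?thesis by auto
      next
        case False
        then obtain s where s: "s\<in>B" "s \<le> t" "B \<inter> {s<..t} = {}" "\<rho> s t \<le> e" using B(3) t by force
        moreover have "A \<inter> {s<..t} = {}" using A(2) B(2) s(1) by fastforce
        ultimately show ?thesis by auto
      qed
      then show "\<exists>A. finite A \<and> A \<subseteq> {a..<c} \<and> (\<forall>t\<in>{a..<c}. \<exists>s\<in>A. s \<le> t \<and> A \<inter> {s<..t} = {} \<and> \<rho> s t \<le> e)"
        using A(1,2) B(1,2) le by (intro exI[of _ "A \<union> B"]) auto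
    qed
  next
    fix x assume x: "0 \<le> x" "x \<le> T"
    have "\<exists>u>x. \<forall>t\<in>{x<..<u}. t < T \<longrightarrow> \<rho> x t \<le> e"
    proof (cases "x < T")
      case True
      then have "\<forall>\<^sub>F t in at_right x. \<rho> x t < e"
        using right[of x] x \<open>e > 0\<close> by (intro order_tendstoD(2)[where y = 0]) auto
      then show ?thesis unfolding eventually_at_right[OF True] by (force intro: less_imp_le)
    next
      case False
      then show ?thesis by (intro exI[of _ "x + 1"]) auto
    qed
    then obtain u where u: "u > x" "\<And>t. x < t \<Longrightarrow> t < u \<Longrightarrow> t < T \<Longrightarrow> \<rho> x t \<le> e" by auto
    have "\<exists>v<x. \<forall>s\<in>{v<..<x}. \<forall>s'\<in>{v<..<x}. 0 \<le> s \<longrightarrow> s \<le> s' \<longrightarrow> \<rho> s s' \<le> e"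
    proof (cases "0 < x")
      case True
      then show ?thesis using left[of x e] x assms(2) by auto
    next
      case False
      then show ?thesis by (intro exI[of _ "x - 1"]) (use x in auto)
    qed
    then obtain v where v: "v < x" "\<And>s s'. v < s \<Longrightarrow> s' < x \<Longrightarrow> 0 \<le> s \<Longrightarrow> s \<le> s' \<Longrightarrow> \<rho> s s' \<le> e"
      by fastforce
    show "\<exists>d>0. \<forall>a b. a \<le> x \<and> x \<le> b \<and> b - a < d \<longrightarrow> P a b"
    proof (intro exI[of _ "min (u - x) (x - v)"] conjI allI impI)
      show "0 < min (u - x) (x - v)" using u v by simp
      fix a b assume ab: "a \<le> x \<and> x \<le> b \<and> b - a < min (u - x) (x - v)"
      show "P a b" unfolding P_def
      \<comment> \<open>Two times suffice near \<open>x\<close>: \<open>a\<close> serves the times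
        before \<open>x\<close>, by the small oscillation to the left, and \<open>x\<close> serves
        the later ones, by right-continuity. Across a jump at \<open>x\<close> a single time could
        not do both.\<close>
      proof (intro impI exI[of _ "{a, x} \<inter> {a..<b}"] conjI ballI)
        fix t assume t: "t \<in> {a..<b}" and a: "0 \<le> a" "b \<le> T"
        show "\<exists>s\<in>{a, x} \<inter> {a..<b}. s \<le> t \<and> {a, x} \<inter> {a..<b} \<inter> {s<..t} = {} \<and> \<rho> s t \<le> e"
        proof (cases "t < x")
          case True
          then show ?thesis using t ab a v(2)[of a t] by (intro bexI[of _ a]) auto
        next
          case False
          have "\<rho> x t \<le> e"
          proof (cases "t = x")
            case True
            then show ?thesis using refl[of x] x \<open>e > 0\<close> by simp
          next
            case F: False
            show ?thesis by (rule u(2)) (use t ab a False F in auto)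
          qed
          then show ?thesis using False t ab by (intro bexI[of _ x]) auto
        qed
      qed auto
    qed
  qed
  then show ?thesis unfolding P_def by auto
qed

text \<open>The time \<open>T\<close> is covered without being put into \<open>A\<close>, so that a
  scheme on \<open>A\<close> has no jump there. Half of \<open>e\<close> leads from the last
  partition time \<open>m\<close> to some \<open>t\<close> near \<open>T\<close>, and
  \<open>leftT\<close> pays for the rest through \<open>tri\<close>.\<close>

lemma cadlag_partition_closed:
  fixes \<rho> :: "real \<Rightarrow> real \<Rightarrow> real"
  assumes "T > 0" "e > 0"
    and refl: "\<And>t. t \<in> {0..T} \<Longrightarrow> \<rho> t t = 0"
    and right: "\<And>t. t \<in> {0..<T} \<Longrightarrow> (\<rho> t \<longlongrightarrow> 0) (at_right t)"
    and left: "\<And>t e. t \<in> {0<..T} \<Longrightarrow> e > 0 \<Longrightarrow> \<exists>u<t. \<forall>s\<in>{u<..<t}. \<forall>s'\<in>{u<..<t}. 0 \<le> s \<longrightarrow> s \<le> s' \<longrightarrow> \<rho> s s' \<le> e"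
    and tri: "\<And>s t u. 0 \<le> s \<Longrightarrow> s \<le> t \<Longrightarrow> t \<le> u \<Longrightarrow> u \<le> T \<Longrightarrow> \<rho> s u \<le> \<rho> s t + \<rho> t u"
    and leftT: "((\<lambda>t. \<rho> t T) \<longlongrightarrow> 0) (at_left T)"
  shows "\<exists>A. finite A \<and> A \<subseteq> {0..<T} \<and>
    (\<forall>t\<in>{0..T}. \<exists>s\<in>A. s \<le> t \<and> A \<inter> {s<..t} = {} \<and> \<rho> s t \<le> e)"
proof -
  have "\<exists>A. finite A \<and> A \<subseteq> {0..<T} \<and>
    (\<forall>t\<in>{0..<T}. \<exists>s\<in>A. s \<le> t \<and> A \<inter> {s<..t} = {} \<and> \<rho> s t \<le> e / 2)"
    by (rule cadlag_partition) (use \<open>T > 0\<close> \<open>e > 0\<close> refl right left in \<open>blast | simp\<close>)+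
  then obtain A where A: "finite A" "A \<subseteq> {0..<T}"
    and P: "\<And>t. t\<in>{0..<T} \<Longrightarrow> \<exists>s\<in>A. s \<le> t \<and> A \<inter> {s<..t} = {} \<and> \<rho> s t \<le> e / 2"
    by blast
  have ne: "A \<noteq> {}" using P[of 0] \<open>T > 0\<close> by auto
  define m where "m = Max A"
  have m: "m \<in> A" "\<And>s. s \<in> A \<Longrightarrow> s \<le> m" using A(1) ne by (auto simp: m_def)
  have m0: "0 \<le> m" "m < T" using m A by auto
  have "\<forall>\<^sub>F t in at_left T. \<rho> t T < e / 2" using leftT \<open>e > 0\<close> by (intro order_tendstoD(2)) auto
  moreover have "\<forall>\<^sub>F t in at_left T. t \<in> {m<..<T}" using m0 by (rule_tac eventually_at_leftI) auto
  ultimately have "\<forall>\<^sub>F t in at_left T. \<rho> t T < e / 2 \<and> t \<in> {m<..<T}" by (rule eventually_conj)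
  then obtain t where t: "\<rho> t T < e / 2" "m < t" "t < T"
    using eventually_happens by fastforce
  obtain s where s: "s\<in>A" "s \<le> t" "A \<inter> {s<..t} = {}" "\<rho> s t \<le> e / 2" using P[of t] t m0 by auto
  have "s = m" using s m t by force
  then have "\<rho> m T \<le> e" using tri[of m t T] s t m0 by auto
  moreover have "A \<inter> {m<..T} = {}" using m(2) by force
  ultimately have "\<exists>s\<in>A. s \<le> T \<and> A \<inter> {s<..T} = {} \<and> \<rho> s T \<le> e" using m m0 by (intro bexI[of _ m]) auto
  moreover have "\<exists>s\<in>A. s \<le> t \<and> A \<inter> {s<..t} = {} \<and> \<rho> s t \<le> e" if "t \<in> {0..<T}" for t
    using P[OF that] \<open>e > 0\<close> by fastforce
  ultimately have "\<forall>t\<in>{0..T}. \<exists>s\<in>A. s \<le> t \<and> A \<inter> {s<..t} = {} \<and> \<rho> s t \<le> e"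
    by (metis atLeastAtMost_iff atLeastLessThan_iff le_less)
  then show ?thesis using A by blast
qed

section \<open>Step approximation of cadlag functions\<close>

lemma left_limit_dist_le:
  fixes f :: "real \<Rightarrow> 'a::metric_space"
  assumes "(f \<longlongrightarrow> l) (at_left t)" "e > 0"
  shows "\<exists>u<t. \<forall>s\<in>{u<..<t}. dist (f s) l \<le> e"
proof -
  have "\<forall>\<^sub>F s in at_left t. dist (f s) l < e" using assms by (rule tendstoD)
  then obtain u where "u < t" "\<And>s. u < s \<Longrightarrow> s < t \<Longrightarrow> dist (f s) l < e"
    using eventually_at_left[of "t - 1" t] by auto
  then show ?thesis by (force intro: less_imp_le)
qed

lemma jump_fun_interpolates:
  fixes f :: "real \<Rightarrow> 'a::ab_group_add"
  assumes "finite B"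
  shows "\<exists>\<gamma>. \<forall>b\<in>B. jump_fun B \<gamma> b = f b"
  using assms
proof (induction B rule: finite_linorder_max_induct)
  case (insert b A)
  then obtain \<gamma> where g: "\<forall>s\<in>A. jump_fun A \<gamma> s = f s" by auto
  have b: "b \<notin> A" using insert by auto
  define \<gamma>' where "\<gamma>' = \<gamma>(b := f b - sum \<gamma> A)"
  have "sum \<gamma>' A = sum \<gamma> A" using b by (intro sum.cong) (auto simp: \<gamma>'_def)
  moreover have "insert b A \<inter> {..b} = insert b A" using insert by auto
  ultimately have "jump_fun (insert b A) \<gamma>' b = f b"
    using insert b by (simp add: jump_fun_def) (simp add: \<gamma>'_def)
  moreover have "jump_fun (insert b A) \<gamma>' s = f s" if "s \<in> A" for s
  proof -
    have "jump_fun (insert b A) \<gamma>' s = jump_fun A \<gamma> s"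
      unfolding jump_fun_def using insert that by (intro sum.cong) (auto simp: \<gamma>'_def)
    then show ?thesis using g that by simp
  qed
  ultimately show ?case by (intro exI[of _ \<gamma>']) auto
qed simp

lemma cadlag_approx_jump_fun:
  fixes f :: "real \<Rightarrow> 'a::real_normed_vector"
  assumes "T > 0" "e > 0" "cadlag_on T f"
  obtains B \<gamma> where "finite B" "\<And>t. t \<in> {0..T} \<Longrightarrow> norm (f t - jump_fun B \<gamma> t) \<le> e"
proof -
  have "\<exists>A. finite A \<and> A \<subseteq> {0..<T} \<and>
    (\<forall>t\<in>{0..<T}. \<exists>s\<in>A. s \<le> t \<and> A \<inter> {s<..t} = {} \<and> dist (f s) (f t) \<le> e)"
  proof (rule cadlag_partition[OF assms(1,2)])
    fix t assume "t \<in> {0..<T}"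
    then have "(f \<longlongrightarrow> f t) (at_right t)" using assms(3) by (auto simp: cadlag_on_def)
    then show "((\<lambda>s. dist (f t) (f s)) \<longlongrightarrow> 0) (at_right t)"
      using tendsto_dist[OF tendsto_const, of f "f t" _ "f t"] by simp
  next
    fix t e :: real assume "t \<in> {0<..T}" "e > 0"
    then have "\<exists>l. (f \<longlongrightarrow> l) (at_left t)" using assms(3) by (simp add: cadlag_on_def)
    then obtain l where "(f \<longlongrightarrow> l) (at_left t)" ..
    then obtain u where u: "u < t" "\<And>s. s\<in>{u<..<t} \<Longrightarrow> dist (f s) l \<le> e / 2"
      using left_limit_dist_le[of f l t "e / 2"] \<open>e > 0\<close> by auto
    have "dist (f s) (f s') \<le> e" if "s \<in> {u<..<t}" "s' \<in> {u<..<t}" for s s'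
      using u(2)[OF that(1)] u(2)[OF that(2)] dist_triangle2[of "f s" "f s'" l] by linarith
    then show "\<exists>u<t. \<forall>s\<in>{u<..<t}. \<forall>s'\<in>{u<..<t}. 0 \<le> s \<longrightarrow> s \<le> s' \<longrightarrow> dist (f s) (f s') \<le> e"
      using u(1) by blast
  qed simp
  then obtain A where A: "finite A" "A \<subseteq> {0..<T}"
    "\<forall>t\<in>{0..<T}. \<exists>s\<in>A. s \<le> t \<and> A \<inter> {s<..t} = {} \<and> dist (f s) (f t) \<le> e" by blast
  \<comment> \<open>\<open>T\<close> is adjoined because \<open>cadlag_on\<close> admits a jump at
    \<open>T\<close>, which the partition of [0,T) does not see.\<close>
  obtain \<gamma> where g: "\<forall>b\<in>insert T A. jump_fun (insert T A) \<gamma> b = f b"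
    using jump_fun_interpolates[of "insert T A" f] A by auto
  have "norm (f t - jump_fun (insert T A) \<gamma> t) \<le> e" if t: "t \<in> {0..T}" for t
  proof (cases "t = T")
    case True
    then show ?thesis using g \<open>e > 0\<close> by simp
  next
    case False
    then obtain s where s: "s\<in>A" "s \<le> t" "A \<inter> {s<..t} = {}" "dist (f s) (f t) \<le> e"
      using bspec[OF A(3), of t] t by auto
    have "jump_fun (insert T A) \<gamma> t = jump_fun (insert T A) \<gamma> s"
      using s t False A by (intro jump_fun_eq) auto
    then show ?thesis using s g by (simp add: dist_norm norm_minus_commute)
  qed
  then show ?thesis using that[of "insert T A" \<gamma>] A by auto
qed

lemma norm_jump_fun_le:
  fixes d :: "real \<Rightarrow> 'a::real_normed_vector"
  assumes "finite A" shows "norm (jump_fun A d t) \<le> (\<Sum>s\<in>A. norm (d s))"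
  unfolding jump_fun_def by (intro order_trans[OF norm_sum] sum_mono2 assms) auto

lemma cadlag_bounded:
  fixes f :: "real \<Rightarrow> 'a::real_normed_vector"
  assumes "T > 0" "cadlag_on T f"
  obtains M where "\<And>t. t \<in> {0..T} \<Longrightarrow> norm (f t) \<le> M"
proof -
  obtain B \<gamma> where B: "finite B" "\<And>t. t \<in> {0..T} \<Longrightarrow> norm (f t - jump_fun B \<gamma> t) \<le> 1"
    using cadlag_approx_jump_fun[of T 1 f] assms by auto
  have "norm (f t) \<le> (\<Sum>b\<in>B. norm (\<gamma> b)) + 1" if "t \<in> {0..T}" for t
    using B(2)[OF that] norm_jump_fun_le[OF B(1), of \<gamma> t] norm_triangle_sub[of "f t" "jump_fun B \<gamma> t"]
    by linarith
  then show ?thesis by (rule that)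
qed

subsection \<open>Hausdorff distance\<close>

lemma hausdorff_dist_commute: "hausdorff_dist A B = hausdorff_dist B A"
  by (simp add: hausdorff_dist_def max.commute)

lemma infdist_le_hausdorff_dist:
  assumes "bounded A" "B \<noteq> {}" "x \<in> A"
  shows "infdist x B \<le> hausdorff_dist A B"
proof -
  obtain b where b: "b \<in> B" using assms by auto
  obtain e where e: "\<forall>x\<in>A. dist b x \<le> e" using assms(1) bounded_any_center[of A b] by blast
  have "bdd_above ((\<lambda>x. infdist x B) ` A)"
  proof (rule bdd_aboveI2)
    fix x assume "x \<in> A"
    then show "infdist x B \<le> e" using infdist_le2[OF b, of x e] e by (simp add: dist_commute)
  qed
  then have "infdist x B \<le> (SUP x\<in>A. infdist x B)" by (rule cSUP_upper[OF assms(3)])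
  then show ?thesis by (simp add: hausdorff_dist_def)
qed

lemma hausdorff_dist_refl: "A \<noteq> {} \<Longrightarrow> hausdorff_dist A A = 0"
  by (simp add: hausdorff_dist_def)

lemma infdist_le_infdist_add_hausdorff_dist:
  assumes "bounded A" "A \<noteq> {}" "B \<noteq> {}"
  shows "infdist x B \<le> infdist x A + hausdorff_dist A B"
proof -
  have "infdist x B - hausdorff_dist A B \<le> (INF a\<in>A. dist x a)"
  proof (rule cINF_greatest[OF assms(2)])
    fix a assume "a \<in> A"
    then show "infdist x B - hausdorff_dist A B \<le> dist x a"
      using infdist_triangle[of x B a] infdist_le_hausdorff_dist[OF assms(1,3), of a] by linarith
  qed
  then show ?thesis using assms by (simp add: infdist_def)
qed

lemma hausdorff_dist_triangle:
  assumes "bounded A" "A \<noteq> {}" "bounded B" "B \<noteq> {}" "bounded C" "C \<noteq> {}"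
  shows "hausdorff_dist A C \<le> hausdorff_dist A B + hausdorff_dist B C"
proof -
  have *: "(SUP x\<in>A. infdist x C) \<le> hausdorff_dist A B + hausdorff_dist B C"
    if "bounded A" "A \<noteq> {}" "C \<noteq> {}" for A C
  proof (rule cSUP_least[OF that(2)])
    fix x assume "x \<in> A"
    then show "infdist x C \<le> hausdorff_dist A B + hausdorff_dist B C"
      using infdist_le_infdist_add_hausdorff_dist[OF assms(3,4) that(3), of x]
        infdist_le_hausdorff_dist[OF that(1) assms(4)] by fastforce
  qed
  show ?thesis
    using *[OF assms(1,2,6)] *[OF assms(5,6,2)]
    by (simp add: hausdorff_dist_def[of A C] hausdorff_dist_commute add.commute)
qed

subsection \<open>Discrete reflection\<close>

lemma convex_bodiesD:
  assumes "A \<in> convex_bodies"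
  shows "bounded A" "closed A" "convex A" "A \<noteq> {}"
  using assms by (auto simp: convex_bodies_def)

text \<open>The catching-up scheme: at a new last time \<open>b\<close> the point reached so far is
  moved to its nearest point in \<open>D b\<close>, and the inequality is the obtuse-angle property
  of that projection. A later jump leaves the earlier positions unchanged, so induction on the
  largest time works.\<close>

lemma discrete_solution_exists:
  fixes y :: "real \<Rightarrow> 'a::euclidean_space"
  assumes "finite A" "\<And>s. s \<in> A \<Longrightarrow> closed (D s) \<and> convex (D s) \<and> D s \<noteq> {}"
  shows "\<exists>d. \<forall>s\<in>A. y s + jump_fun A d s \<in> D s \<and> (\<forall>w\<in>D s. (y s + jump_fun A d s - w) \<bullet> d s \<le> 0)"
  using assms
proof (induction A rule: finite_linorder_max_induct)
  case (insert b A)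
  then have "\<exists>d. \<forall>s\<in>A. y s + jump_fun A d s \<in> D s \<and> (\<forall>w\<in>D s. (y s + jump_fun A d s - w) \<bullet> d s \<le> 0)"
    by (intro insert.IH) auto
  then obtain d where d: "\<forall>s\<in>A. y s + jump_fun A d s \<in> D s \<and>
      (\<forall>w\<in>D s. (y s + jump_fun A d s - w) \<bullet> d s \<le> 0)" ..
  have b: "b \<notin> A" using insert by auto
  define v where "v = y b + sum d A"
  define p where "p = closest_point (D b) v"
  have Db: "closed (D b)" "convex (D b)" "D b \<noteq> {}" using insert.prems by auto
  define d' where "d' = d(b := p - v)"
  have "sum d' A = sum d A" using b by (intro sum.cong) (auto simp: d'_def)
  moreover have "insert b A \<inter> {..b} = insert b A" using insert by auto
  ultimately have jb: "y b + jump_fun (insert b A) d' b = p"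
    using insert b by (simp add: jump_fun_def) (simp add: d'_def v_def)
  have "p \<in> D b" unfolding p_def by (rule closest_point_in_set) (use Db in auto)
  moreover have "(p - w) \<bullet> d' b \<le> 0" if "w \<in> D b" for w
    using closest_point_dot[OF Db(2,1) that, of v] unfolding d'_def p_def[symmetric]
    by (simp add: algebra_simps inner_commute)
  moreover have "jump_fun (insert b A) d' s = jump_fun A d s" "d' s = d s" if "s \<in> A" for s
    unfolding jump_fun_def using insert that by (auto intro!: sum.cong simp: d'_def)
  ultimately show ?case using d jb by (intro exI[of _ d']) auto
qed simp

text \<open>The sum is a difference of two values of \<open>jump_fun\<close>, one of them taken in
  the gap of \<open>A\<close> just before \<open>b\<close>; hence the factor 2. This supplies the
  tail sums required by \<open>sum_jump_fun_inner_le\<close>.\<close>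

lemma norm_sum_ge_le:
  fixes d :: "real \<Rightarrow> 'a::real_normed_vector"
  assumes "finite A" and K: "\<And>t. norm (jump_fun A d t) \<le> K"
  shows "norm (sum d {s \<in> A \<inter> {..t}. b \<le> s}) \<le> 2 * K"
proof -
  obtain u where u: "u < b" "A \<inter> {u<..<b} = {}" using finite_gap_left[OF assms(1)] .
  have eq: "{s \<in> A \<inter> {..t}. b \<le> s} = A \<inter> {u<..t}" using u by auto
  show ?thesis
  proof (cases "u \<le> t")
    case True
    show ?thesis
      unfolding eq jump_fun_diff[OF assms(1) True, symmetric]
      using K[of t] K[of u] norm_triangle_ineq4[of "jump_fun A d t" "jump_fun A d u"] by linarith
  next
    case False
    then have "A \<inter> {u<..t} = {}" by auto
    then show ?thesis unfolding eq using order_trans[OF norm_ge_zero K] by simp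
  qed
qed

text \<open>In the application \<open>h\<close> is \<open>a - y\<close>. Let K be the supremum of
  the jump function and G the total jump size of a step approximation of \<open>h\<close>. Summing
  the hypothesis up to t bounds \<open>r / 2\<close> times the variation plus half the squared norm
  at t by 2 K G. At a time where K is attained this gives K <= 4 G; at \<open>T\<close> the
  variation is then at most 8 G^2 divided by \<open>r / 2\<close>, whatever \<open>A\<close> and
  \<open>d\<close> are.\<close>

lemma discrete_variation_bound:
  fixes h :: "real \<Rightarrow> 'a::real_inner"
  assumes "T > 0" "r > 0" "cadlag_on T h"
  shows "\<exists>V. \<forall>A d. finite A \<longrightarrow> A \<subseteq> {0..T} \<longrightarrow>
    (\<forall>s\<in>A. r * norm (d s) \<le> (h s - jump_fun A d s) \<bullet> d s) \<longrightarrow> (\<Sum>s\<in>A. norm (d s)) \<le> V"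
proof -
  obtain B \<gamma> where B: "finite B" "\<And>t. t \<in> {0..T} \<Longrightarrow> norm (h t - jump_fun B \<gamma> t) \<le> r / 2"
    using cadlag_approx_jump_fun[of T "r / 2" h] assms by auto
  define G where "G = (\<Sum>b\<in>B. norm (\<gamma> b))"
  have G: "0 \<le> G" unfolding G_def by (intro sum_nonneg) auto
  have bound: "(\<Sum>s\<in>A. norm (d s)) \<le> 16 * G\<^sup>2 / r"
    if A: "finite A" "A \<subseteq> {0..T}" and d: "\<And>s. s\<in>A \<Longrightarrow> r * norm (d s) \<le> (h s - jump_fun A d s) \<bullet> d s" for A d
  proof -
    \<comment> \<open>A jump function takes finitely many values, so its supremum K is
      attained.\<close>
    have "range (jump_fun A d) \<subseteq> sum d ` Pow A" by (auto simp: jump_fun_def)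
    then have fin: "finite (range (\<lambda>t. norm (jump_fun A d t)))"
      by (metis finite_Pow_iff finite_imageI finite_subset A(1) range_composition)
    define K where "K = Max (range (\<lambda>t. norm (jump_fun A d t)))"
    have K: "norm (jump_fun A d t) \<le> K" for t unfolding K_def by (intro Max_ge fin) auto
    have K0: "0 \<le> K" using order_trans[OF norm_ge_zero K] .
    have "K \<in> range (\<lambda>t. norm (jump_fun A d t))" unfolding K_def by (intro Max_in fin) auto
    then obtain t0 where t0: "K = norm (jump_fun A d t0)" by auto
    have main: "r / 2 * (\<Sum>s\<in>A \<inter> {..t}. norm (d s)) + (norm (jump_fun A d t))\<^sup>2 / 2 \<le> 2 * K * G" for t
    proof -
      have "r * (\<Sum>s\<in>A \<inter> {..t}. norm (d s)) \<le> (\<Sum>s\<in>A \<inter> {..t}. (h s - jump_fun A d s) \<bullet> d s)"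
        unfolding sum_distrib_left by (intro sum_mono d) auto
      also have "\<dots> = (\<Sum>s\<in>A \<inter> {..t}. (h s - jump_fun B \<gamma> s) \<bullet> d s) +
          (\<Sum>s\<in>A \<inter> {..t}. jump_fun B \<gamma> s \<bullet> d s) - (\<Sum>s\<in>A \<inter> {..t}. jump_fun A d s \<bullet> d s)"
        by (simp add: sum.distrib[symmetric] sum_subtractf[symmetric] algebra_simps)
      also have "(\<Sum>s\<in>A \<inter> {..t}. (h s - jump_fun B \<gamma> s) \<bullet> d s) \<le> (\<Sum>s\<in>A \<inter> {..t}. r / 2 * norm (d s))"
        by (intro sum_mono order_trans[OF norm_cauchy_schwarz] mult_right_mono B) (use A in auto)
      also have "\<dots> = r / 2 * (\<Sum>s\<in>A \<inter> {..t}. norm (d s))" by (simp add: sum_distrib_left)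
      also have "(\<Sum>s\<in>A \<inter> {..t}. jump_fun B \<gamma> s \<bullet> d s) \<le> 2 * K * G"
        using sum_jump_fun_inner_le[OF B(1), where I = "A \<inter> {..t}" and q = "\<lambda>s. s" and d = d and K = "2 * K" and \<gamma> = \<gamma>]
          norm_sum_ge_le[OF A(1) K] A(1) by (simp add: G_def)
      finally show ?thesis using norm_jump_fun_sq_le[OF A(1), of d t] by (simp add: field_simps)
    qed
    have "0 \<le> r / 2 * (\<Sum>s\<in>A \<inter> {..t0}. norm (d s))" using \<open>r > 0\<close> by (intro mult_nonneg_nonneg sum_nonneg) auto
    then have "K\<^sup>2 / 2 \<le> 2 * K * G" using main[of t0] unfolding t0[symmetric] by linarith
    then have "K * K \<le> 4 * G * K" by (simp add: power2_eq_square algebra_simps)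
    then have K4: "K \<le> 4 * G" using K0 G by (cases "K = 0") auto
    have "A \<inter> {..T} = A" using A by auto
    then have "r / 2 * (\<Sum>s\<in>A. norm (d s)) \<le> 2 * K * G" using main[of T] zero_le_power2[of "norm (jump_fun A d T)"]
      by (smt (verit) divide_nonneg_pos)
    also have "\<dots> \<le> 8 * G\<^sup>2" using mult_right_mono[OF K4 G] by (simp add: power2_eq_square algebra_simps)
    finally show ?thesis using \<open>r > 0\<close> by (simp add: field_simps)
  qed
  show ?thesis
    by (intro exI[of _ "16 * G\<^sup>2 / r"] allI impI, rule bound) auto
qed

text \<open>Testing with a point outside \<open>C\<close> costs at most its distance to
  \<open>C\<close>, by a detour through its nearest point. In \<open>discrete_stability\<close> the
  point is the position of the other scheme, which may lie slightly outside the set.\<close>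

lemma inner_le_infdist:
  fixes x :: "'a::euclidean_space"
  assumes "closed C" "C \<noteq> {}" "\<And>w. w \<in> C \<Longrightarrow> (x - w) \<bullet> d \<le> 0"
  shows "(x - v) \<bullet> d \<le> infdist v C * norm d"
proof -
  obtain c where c: "c \<in> C" "infdist v C = dist v c" using infdist_attains_inf[OF assms(1,2)] by metis
  have "(x - v) \<bullet> d = (x - c) \<bullet> d + (c - v) \<bullet> d" by (simp add: algebra_simps)
  also have "\<dots> \<le> 0 + norm (c - v) * norm d" by (intro add_mono assms(3) c norm_cauchy_schwarz)
  finally show ?thesis using c by (simp add: dist_norm norm_minus_commute)
qed

text \<open>Each jump of one scheme is tested with the position of the other, which is within
  \<open>e'\<close> of the set at the times of \<open>A\<close> and within \<open>e\<close> at those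
  of \<open>B\<close>. Both positions contain the same \<open>y\<close>, so their difference is the
  difference u of the jump functions, and the chain rule inequality gives |u|^2 / 2 <= e' V + e
  V.\<close>

lemma discrete_stability:
  fixes y :: "real \<Rightarrow> 'a::euclidean_space"
  assumes fin: "finite A" "finite B"
    and D: "\<And>s. s \<in> A \<union> B \<Longrightarrow> closed (D s) \<and> D s \<noteq> {}"
    and d: "\<And>s w. s \<in> A \<Longrightarrow> w \<in> D s \<Longrightarrow> (y s + jump_fun A d s - w) \<bullet> d s \<le> 0"
    and d': "\<And>s w. s \<in> B \<Longrightarrow> w \<in> D s \<Longrightarrow> (y s + jump_fun B d' s - w) \<bullet> d' s \<le> 0"
    and dist: "\<And>s. s \<in> B \<Longrightarrow> infdist (y s + jump_fun A d s) (D s) \<le> e"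
      "\<And>s. s \<in> A \<Longrightarrow> infdist (y s + jump_fun B d' s) (D s) \<le> e'"
    and nonneg: "e \<ge> 0" "e' \<ge> 0"
    and V: "(\<Sum>s\<in>A. norm (d s)) \<le> V" "(\<Sum>s\<in>B. norm (d' s)) \<le> V"
  shows "(norm (jump_fun A d t - jump_fun B d' t))\<^sup>2 \<le> 2 * (e + e') * V"
proof -
  let ?u = "\<lambda>t. jump_fun A d t - jump_fun B d' t"
  \<comment> \<open>Extension by zero puts both families of jumps on the common grid
    \<open>A \<union> B\<close>, where the difference is a single jump function.\<close>
  define d1 where "d1 s = (if s \<in> A then d s else 0)" for s
  define d2 where "d2 s = (if s \<in> B then d' s else 0)" for s
  have r1: "\<And>f::real\<Rightarrow>'a. \<And>t. (\<And>s. s \<notin> A \<Longrightarrow> f s = 0) \<Longrightarrow> sum f ((A \<union> B) \<inter> {..t}) = sum f (A \<inter> {..t})"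
      "\<And>f::real\<Rightarrow>real. \<And>t. (\<And>s. s \<notin> A \<Longrightarrow> f s = 0) \<Longrightarrow> sum f ((A \<union> B) \<inter> {..t}) = sum f (A \<inter> {..t})"
    using fin by (auto intro!: sum.mono_neutral_right)
  have r2: "\<And>f::real\<Rightarrow>'a. \<And>t. (\<And>s. s \<notin> B \<Longrightarrow> f s = 0) \<Longrightarrow> sum f ((A \<union> B) \<inter> {..t}) = sum f (B \<inter> {..t})"
      "\<And>f::real\<Rightarrow>real. \<And>t. (\<And>s. s \<notin> B \<Longrightarrow> f s = 0) \<Longrightarrow> sum f ((A \<union> B) \<inter> {..t}) = sum f (B \<inter> {..t})"
    using fin by (auto intro!: sum.mono_neutral_right)
  have u: "jump_fun (A \<union> B) (\<lambda>s. d1 s - d2 s) t = ?u t" for t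
    unfolding jump_fun_def sum_subtractf
    using r1(1)[of d1 t] r2(1)[of d2 t] by (simp add: d1_def d2_def)
  have "(norm (?u t))\<^sup>2 / 2 \<le> (\<Sum>s\<in>(A \<union> B) \<inter> {..t}. ?u s \<bullet> (d1 s - d2 s))"
    using norm_jump_fun_sq_le[of "A \<union> B" "\<lambda>s. d1 s - d2 s" t] fin unfolding u by simp
  also have "\<dots> = (\<Sum>s\<in>(A \<union> B) \<inter> {..t}. ?u s \<bullet> d1 s) + (\<Sum>s\<in>(A \<union> B) \<inter> {..t}. (- ?u s) \<bullet> d2 s)"
    by (simp add: sum.distrib[symmetric] algebra_simps)
  also have "(\<Sum>s\<in>(A \<union> B) \<inter> {..t}. ?u s \<bullet> d1 s) = (\<Sum>s\<in>A \<inter> {..t}. ?u s \<bullet> d s)"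
    by (subst r1(2)) (auto simp: d1_def)
  also have "(\<Sum>s\<in>(A \<union> B) \<inter> {..t}. (- ?u s) \<bullet> d2 s) = (\<Sum>s\<in>B \<inter> {..t}. (- ?u s) \<bullet> d' s)"
    by (subst r2(2)) (auto simp: d2_def)
  also have "(\<Sum>s\<in>A \<inter> {..t}. ?u s \<bullet> d s) \<le> (\<Sum>s\<in>A \<inter> {..t}. e' * norm (d s))"
  proof (rule sum_mono)
    fix s assume s: "s \<in> A \<inter> {..t}"
    have "?u s \<bullet> d s = (y s + jump_fun A d s - (y s + jump_fun B d' s)) \<bullet> d s" by simp
    also have "\<dots> \<le> infdist (y s + jump_fun B d' s) (D s) * norm (d s)"
      using s D d by (intro inner_le_infdist) auto
    also have "\<dots> \<le> e' * norm (d s)" using s dist by (intro mult_right_mono) auto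
    finally show "?u s \<bullet> d s \<le> e' * norm (d s)" .
  qed
  also have "(\<Sum>s\<in>B \<inter> {..t}. (- ?u s) \<bullet> d' s) \<le> (\<Sum>s\<in>B \<inter> {..t}. e * norm (d' s))"
  proof (rule sum_mono)
    fix s assume s: "s \<in> B \<inter> {..t}"
    have "(- ?u s) \<bullet> d' s = (y s + jump_fun B d' s - (y s + jump_fun A d s)) \<bullet> d' s" by simp
    also have "\<dots> \<le> infdist (y s + jump_fun A d s) (D s) * norm (d' s)"
      using s D d' by (intro inner_le_infdist) auto
    also have "\<dots> \<le> e * norm (d' s)" using s dist by (intro mult_right_mono) auto
    finally show "(- ?u s) \<bullet> d' s \<le> e * norm (d' s)" .
  qed
  also have "(\<Sum>s\<in>A \<inter> {..t}. e' * norm (d s)) \<le> (\<Sum>s\<in>A. e' * norm (d s))"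
    using fin nonneg by (intro sum_mono2) auto
  also have "\<dots> \<le> e' * V" unfolding sum_distrib_left[symmetric] by (intro mult_left_mono V nonneg)
  also have "(\<Sum>s\<in>B \<inter> {..t}. e * norm (d' s)) \<le> (\<Sum>s\<in>B. e * norm (d' s))"
    using fin nonneg by (intro sum_mono2) auto
  also have "\<dots> \<le> e * V" unfolding sum_distrib_left[symmetric] by (intro mult_left_mono V nonneg)
  finally show ?thesis by (simp add: algebra_simps)
qed

subsection \<open>Total variation\<close>

lemma eventually_at_right_realE:
  fixes x :: real
  assumes "\<forall>\<^sub>F s in at_right x. P s"
  obtains u where "u > x" "\<And>s. x < s \<Longrightarrow> s < u \<Longrightarrow> P s"
  using assms unfolding eventually_at_right[of x "x + 1", simplified] by metis

lemma partition_mono: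
  fixes p :: "nat \<Rightarrow> real"
  assumes "\<forall>i<n. p i \<le> p (Suc i)" "i \<le> j" "j \<le> n"
  shows "p i \<le> p j"
  using assms(2,3)
proof (induction rule: dec_induct)
  case (step m)
  then show ?case using assms(1)[rule_format, of m] by simp
qed simp

lemma variation_sums_le:
  assumes "\<And>s u. 0 \<le> s \<Longrightarrow> s \<le> u \<Longrightarrow> u \<le> t \<Longrightarrow> norm (k u - k s) \<le> G u - G s" "v \<in> variation_sums k t"
  shows "v \<le> G t - G 0"
proof -
  obtain p n where p: "v = (\<Sum>i<n. norm (k (p (Suc i)) - k (p i)))" "p 0 = 0" "p n = t"
    "\<forall>i<n. p i \<le> p (Suc i)" using assms(2) by (auto simp: variation_sums_def)
  have "v \<le> (\<Sum>i<n. G (p (Suc i)) - G (p i))" unfolding p(1)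
  proof (rule sum_mono)
    fix i assume "i \<in> {..<n}"
    then show "norm (k (p (Suc i)) - k (p i)) \<le> G (p (Suc i)) - G (p i)"
      using partition_mono[OF p(4), of 0 i] partition_mono[OF p(4), of "Suc i" n] p by (intro assms(1)) auto
  qed
  then show ?thesis using p(2,3) sum_lessThan_telescope[of "\<lambda>i. G (p i)" n] by simp
qed

lemma variation_sums_append:
  assumes v: "v \<in> variation_sums k s" and q: "q 0 = s" "q m = t" "\<forall>i<m. q i \<le> q (Suc i)"
  shows "v + (\<Sum>i<m. norm (k (q (Suc i)) - k (q i))) \<in> variation_sums k t"
proof -
  obtain p n where p: "v = (\<Sum>i<n. norm (k (p (Suc i)) - k (p i)))" "p 0 = 0" "p n = s"
    "\<forall>i<n. p i \<le> p (Suc i)" using v by (auto simp: variation_sums_def)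
  define r where "r i = (if i \<le> n then p i else q (i - n))" for i
  have rq: "r (n + i) = q i" for i using p q by (auto simp: r_def)
  have "(\<Sum>i<n + m. norm (k (r (Suc i)) - k (r i))) =
      (\<Sum>i<n. norm (k (r (Suc i)) - k (r i))) + (\<Sum>i<m. norm (k (r (n + Suc i)) - k (r (n + i))))"
    by (induction m) (simp_all add: add_ac)
  also have "(\<Sum>i<m. norm (k (r (n + Suc i)) - k (r (n + i)))) = (\<Sum>i<m. norm (k (q (Suc i)) - k (q i)))"
    unfolding rq ..
  also have "(\<Sum>i<n. norm (k (r (Suc i)) - k (r i))) = v" unfolding p(1) by (intro sum.cong) (auto simp: r_def)
  finally have "v + (\<Sum>i<m. norm (k (q (Suc i)) - k (q i))) = (\<Sum>i<n + m. norm (k (r (Suc i)) - k (r i)))" by simp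
  moreover have "r i \<le> r (Suc i)" if i: "i < n + m" for i
  proof (cases "i < n")
    case True
    then show ?thesis using p by (simp add: r_def)
  next
    case False
    then have "r i = q (i - n)" "r (Suc i) = q (Suc (i - n))" using rq[of "i - n"] rq[of "Suc (i - n)"] by auto
    then show ?thesis using q(3) i False by auto
  qed
  moreover have "r 0 = 0" "r (n + m) = t" using p q rq by (auto simp: r_def)
  ultimately show ?thesis unfolding variation_sums_def by blast
qed

lemma zero_in_variation_sums: "0 \<in> variation_sums k 0"
  unfolding variation_sums_def by (rule CollectI, intro exI[of _ "\<lambda>_. 0"] exI[of _ 0]) auto

lemma variation_sums_append_point:
  assumes "v \<in> variation_sums k s" "s \<le> t"
  shows "v + norm (k t - k s) \<in> variation_sums k t"
  using variation_sums_append[OF assms(1), of "\<lambda>i. if i = 0 then s else t" 1 t] assms(2) by simp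

lemma variation_sums_nonempty: "0 \<le> t \<Longrightarrow> variation_sums k t \<noteq> {}"
  using variation_sums_append_point[OF zero_in_variation_sums] by blast

lemma bdd_above_variation_sums:
  assumes "finite_variation T k" "t \<le> T"
  shows "bdd_above (variation_sums k t)"
proof -
  obtain M where M: "\<And>v. v \<in> variation_sums k T \<Longrightarrow> v \<le> M"
    using assms(1) by (auto simp: finite_variation_def bdd_above_def)
  show ?thesis
  proof (rule bdd_aboveI)
    fix v assume "v \<in> variation_sums k t"
    then have "v + norm (k T - k t) \<le> M" by (intro M variation_sums_append_point assms)
    then show "v \<le> M" using norm_ge_zero[of "k T - k t"] by linarith
  qed
qed

text \<open>Superadditivity of the variation. It is stated for a whole chain \<open>q\<close>
  because \<open>total_variation_right_bound\<close> applies it to the tail of a partition.\<close>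

lemma total_variation_append:
  assumes "finite_variation T k" "0 \<le> s" "t \<le> T" and q: "q 0 = s" "q m = t" "\<forall>i<m. q i \<le> q (Suc i)"
  shows "total_variation k s + (\<Sum>i<m. norm (k (q (Suc i)) - k (q i))) \<le> total_variation k t"
proof -
  have "total_variation k s \<le> total_variation k t - (\<Sum>i<m. norm (k (q (Suc i)) - k (q i)))"
    unfolding total_variation_def[of k s]
  proof (rule cSup_least[OF variation_sums_nonempty[OF assms(2)]])
    fix v assume "v \<in> variation_sums k s"
    from cSup_upper[OF variation_sums_append[OF this q] bdd_above_variation_sums[OF assms(1,3)]]
    show "v \<le> total_variation k t - (\<Sum>i<m. norm (k (q (Suc i)) - k (q i)))"
      by (simp add: total_variation_def)
  qed
  then show ?thesis by simp
qed

lemma norm_diff_le_total_variation_diff: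
  assumes "finite_variation T k" "0 \<le> s" "s \<le> t" "t \<le> T"
  shows "norm (k t - k s) \<le> total_variation k t - total_variation k s"
  using total_variation_append[OF assms(1,2,4), of "\<lambda>i. if i = 0 then s else t" 1] assms(3) by simp

text \<open>The nontrivial half of the right-continuity of the variation. A partition of [0,T] that
  almost attains the variation is cut at \<open>s\<close> and \<open>s'\<close>. The outer pieces
  cost at most the variation up to \<open>s\<close> and that from \<open>s'\<close> to
  \<open>T\<close>; the middle piece has at most \<open>n\<close> increments, all between times
  close to \<open>s\<close>. Comparison with the variation on [0,T] leaves little room between
  \<open>s\<close> and \<open>s'\<close>.\<close>

lemma total_variation_right_bound:
  assumes fv: "finite_variation T k" and s: "0 \<le> s" "s < T"
    and right: "(k \<longlongrightarrow> k s) (at_right s)" and "e > 0"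
  shows "\<exists>u>s. \<forall>s'\<in>{s<..<u}. s' \<le> T \<longrightarrow> total_variation k s' \<le> total_variation k s + e"
proof -
  have ne: "variation_sums k T \<noteq> {}" using s by (intro variation_sums_nonempty) auto
  have "\<exists>v\<in>variation_sums k T. total_variation k T - e / 2 < v"
    using less_cSup_iff[OF ne bdd_above_variation_sums[OF fv order_refl], of "total_variation k T - e / 2"]
      \<open>e > 0\<close> by (simp add: total_variation_def)
  then obtain p n where v: "total_variation k T - e / 2 < (\<Sum>i<n. norm (k (p (Suc i)) - k (p i)))"
    and p: "p 0 = 0" "p n = T" "\<forall>i<n. p i \<le> p (Suc i)" by (auto simp: variation_sums_def)
  \<comment> \<open>Each of the \<open>n\<close> increments in the middle piece is at most
    \<open>2 * c\<close>, so together they stay below \<open>e / 2\<close>; the other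
    \<open>e / 2\<close> is the defect of the partition.\<close>
  define c where "c = e / (4 * (real n + 1))"
  have "c > 0" using \<open>e > 0\<close> by (simp add: c_def add_nonneg_pos)
  then have "\<forall>\<^sub>F s' in at_right s. dist (k s') (k s) < c" by (rule tendstoD[OF right])
  then obtain u where u: "u > s" "\<And>s'. s < s' \<Longrightarrow> s' < u \<Longrightarrow> dist (k s') (k s) < c"
    using eventually_at_right_realE by blast
  have kc: "norm (k s' - k s) \<le> c" if "s \<le> s'" "s' < u" for s'
    using u(2)[of s'] that \<open>c > 0\<close> by (cases "s = s'") (auto simp: dist_norm intro: less_imp_le)
  have "total_variation k s' \<le> total_variation k s + e" if s': "s < s'" "s' < u" "s' \<le> T" for s'
  proof -
    \<comment> \<open>Clamping the partition to each of the three intervals keeps its index set;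
      repeated points contribute zero increments.\<close>
    define pa where "pa i = min (p i) s" for i
    define pb where "pb i = min (max (p i) s) s'" for i
    define pc where "pc i = max (p i) s'" for i
    let ?S = "\<lambda>q. \<Sum>i<n. norm (k (q (Suc i)) - k (q i))"
    have split: "norm (k (p (Suc i)) - k (p i)) \<le> norm (k (pa (Suc i)) - k (pa i)) +
        norm (k (pb (Suc i)) - k (pb i)) + norm (k (pc (Suc i)) - k (pc i))" for i
    proof -
      \<comment> \<open>Wherever \<open>p i\<close> lies, one of the three clamped points is
        \<open>p i\<close> and the others are interval ends, whose values cancel.\<close>
      have dec: "k (p i) = k (pa i) + (k (pb i) - k s) + (k (pc i) - k s')" for i
        using s' by (auto simp: pa_def pb_def pc_def min_def max_def)
      have "k (p (Suc i)) - k (p i) = (k (pa (Suc i)) - k (pa i)) + (k (pb (Suc i)) - k (pb i)) +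
          (k (pc (Suc i)) - k (pc i))" unfolding dec[of i] dec[of "Suc i"] by simp
      then show ?thesis by (metis norm_triangle_le add_mono order_refl norm_triangle_ineq)
    qed
    have "?S p \<le> ?S pa + ?S pb + ?S pc"
      unfolding sum.distrib[symmetric] by (intro sum_mono split)
    moreover have "?S pa \<le> total_variation k s" unfolding total_variation_def
    proof (rule cSup_upper)
      show "?S pa \<in> variation_sums k s" unfolding variation_sums_def
        by (rule CollectI, intro exI[of _ pa] exI[of _ n]) (use p s in \<open>auto simp: pa_def min_le_iff_disj\<close>)
    qed (use bdd_above_variation_sums[OF fv] s in auto)
    moreover have "total_variation k s' + ?S pc \<le> total_variation k T"
      by (rule total_variation_append[OF fv]) (use p s s' in \<open>auto simp: pc_def le_max_iff_disj\<close>)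
    moreover have "?S pb \<le> e / 2"
    proof -
      have "norm (k (pb (Suc i)) - k (pb i)) \<le> 2 * c" for i
      proof -
        have "s \<le> pb j \<and> pb j < u" for j using s' by (auto simp: pb_def)
        then show ?thesis
          using kc[of "pb i"] kc[of "pb (Suc i)"]
            norm_triangle_ineq4[of "k (pb (Suc i)) - k s" "k (pb i) - k s"] by fastforce
      qed
      then have "?S pb \<le> (\<Sum>i<n. 2 * c)" by (intro sum_mono)
      also have "\<dots> = e / 2 * (real n / (real n + 1))" by (simp add: c_def field_simps)
      also have "\<dots> \<le> e / 2 * 1" using \<open>e > 0\<close> by (intro mult_left_mono) auto
      finally show ?thesis by simp
    qed
    ultimately show ?thesis using v by linarith
  qed
  then show ?thesis using u(1) by auto
qed

subsection \<open>Stieltjes integrals as limits of right-endpoint sums\<close>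

text \<open>There are \<open>Suc N\<close> cells, so that the mesh makes sense for every
  \<open>N\<close>.\<close>

definition grid :: "real \<Rightarrow> nat \<Rightarrow> nat \<Rightarrow> real" where
  "grid t N i = t * real i / real (Suc N)"

text \<open>For right-continuous \<open>f\<close> the right ends pair a jump of \<open>k\<close> at
  a time s with \<open>f s\<close>, as the Lebesgue-Stieltjes integral does; left ends would produce
  the left limit of \<open>f\<close> instead.\<close>

definition right_sum :: "real \<Rightarrow> (real \<Rightarrow> 'a::real_inner) \<Rightarrow> (real \<Rightarrow> 'a) \<Rightarrow> nat \<Rightarrow> real" where
  "right_sum t f k N =
    (\<Sum>i<Suc N. f (grid t N (Suc i)) \<bullet> (k (grid t N (Suc i)) - k (grid t N i)))"

text \<open>Evaluating at right endpoints makes these step functions converge pointwise to \<open>f\<close>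
  whenever \<open>f\<close> is right-continuous.\<close>

definition right_step :: "real \<Rightarrow> (real \<Rightarrow> 'a::real_normed_vector) \<Rightarrow> nat \<Rightarrow> real \<Rightarrow> 'a" where
  "right_step t f N s =
    (\<Sum>i<Suc N. indicator {grid t N i<..grid t N (Suc i)} s *\<^sub>R f (grid t N (Suc i)))"

lemma grid_simps [simp]: "grid t N 0 = 0" "grid t N (Suc N) = t"
  by (simp_all add: grid_def del: of_nat_Suc)

lemma grid_mono: "0 \<le> t \<Longrightarrow> i \<le> j \<Longrightarrow> grid t N i \<le> grid t N j"
  unfolding grid_def by (intro divide_right_mono mult_left_mono) auto

lemma grid_in: "0 \<le> t \<Longrightarrow> i \<le> Suc N \<Longrightarrow> grid t N i \<in> {0..t}"
  using grid_mono[of t 0 i N] grid_mono[of t i "Suc N" N] by simp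

lemma right_step_eq:
  assumes "s \<in> {0<..t}"
  obtains c where "s \<le> c" "c \<le> t" "c < s + t / real (Suc N)" "right_step t f N s = f c"
proof -
  have t: "0 \<le> t" using assms by auto
  define m where "m = (LEAST m. s \<le> grid t N m)"
  have ex: "s \<le> grid t N (Suc N)" using assms by simp
  have m: "s \<le> grid t N m" unfolding m_def by (rule LeastI[where P = "\<lambda>m. s \<le> grid t N m", OF ex])
  have mN: "m \<le> Suc N" unfolding m_def by (rule Least_le[where P = "\<lambda>m. s \<le> grid t N m", OF ex])
  have "m \<noteq> 0" using m assms by (cases m) auto
  then obtain i where i: "m = Suc i" by (cases m) auto
  have less: "grid t N i < s" using not_less_Least[of i "\<lambda>m. s \<le> grid t N m"] i by (simp add: m_def)
  have "right_step t f N s = (\<Sum>j<Suc N. if j = i then f (grid t N (Suc i)) else 0)"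
    unfolding right_step_def
  proof (intro sum.cong refl)
    fix j
    show "indicator {grid t N j<..grid t N (Suc j)} s *\<^sub>R f (grid t N (Suc j)) =
        (if j = i then f (grid t N (Suc i)) else 0)"
    proof (cases j i rule: linorder_cases)
      case equal
      then show ?thesis using m i less by simp
    next
      case less': less
      then have "grid t N (Suc j) < s" using grid_mono[OF t, of "Suc j" i N] less by simp
      then show ?thesis using less' by simp
    next
      case greater
      then have "s \<le> grid t N j" using grid_mono[OF t, of "Suc i" j N] m i by simp
      then show ?thesis using greater by simp
    qed
  qed
  also have "\<dots> = f (grid t N (Suc i))" using mN i by simp
  finally have "right_step t f N s = f (grid t N (Suc i))" .
  moreover have "grid t N (Suc i) = grid t N i + t / real (Suc N)"
    unfolding grid_def of_nat_Suc[of i] by (simp add: distrib_left add_divide_distrib del: of_nat_Suc)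
  moreover have "grid t N (Suc i) \<le> t" using grid_in[OF t mN] i by simp
  ultimately show ?thesis using that[of "grid t N (Suc i)"] m i less by simp
qed

lemma right_step_zero:
  assumes "s \<notin> {0<..t}" "0 \<le> t"
  shows "right_step t f N s = 0"
  unfolding right_step_def
proof (rule sum.neutral, rule ballI)
  fix i assume "i \<in> {..<Suc N}"
  then have "s \<notin> {grid t N i<..grid t N (Suc i)}"
    using assms grid_in[OF assms(2), of i N] grid_in[OF assms(2), of "Suc i" N] by auto
  then show "indicator {grid t N i<..grid t N (Suc i)} s *\<^sub>R f (grid t N (Suc i)) = 0" by simp
qed

lemma right_step_tendsto:
  fixes f :: "real \<Rightarrow> 'a::real_normed_vector"
  assumes s: "s \<in> {0<..t}" and right: "s < t \<Longrightarrow> (f \<longlongrightarrow> f s) (at_right s)"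
  shows "(\<lambda>N. right_step t f N s) \<longlonglongrightarrow> f s"
proof (rule tendstoI)
  fix e :: real assume "e > 0"
  have "\<exists>u>s. \<forall>c\<in>{s..<u}. c \<le> t \<longrightarrow> dist (f c) (f s) < e"
  proof (cases "s < t")
    case True
    have "\<forall>\<^sub>F c in at_right s. dist (f c) (f s) < e" using right[OF True] \<open>e > 0\<close> by (rule tendstoD)
    then obtain u where "u > s" "\<And>c. s < c \<Longrightarrow> c < u \<Longrightarrow> dist (f c) (f s) < e"
      using eventually_at_right_realE by blast
    then show ?thesis using \<open>e > 0\<close> by (intro exI[of _ u]) (auto simp: le_less)
  next
    case False
    \<comment> \<open>At the end point \<open>t\<close> the bounds s <= c <= t leave only c = s, so
      no right limit at \<open>t\<close> enters.\<close>
    then show ?thesis using s \<open>e > 0\<close> by (intro exI[of _ "s + 1"]) auto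
  qed
  then obtain u where u: "u > s" "\<And>c. s \<le> c \<Longrightarrow> c < u \<Longrightarrow> c \<le> t \<Longrightarrow> dist (f c) (f s) < e" by auto
  have "(\<lambda>N. t / real (Suc N)) \<longlonglongrightarrow> 0" by (rule LIMSEQ_Suc[OF lim_const_over_n])
  then have "\<forall>\<^sub>F N in sequentially. t / real (Suc N) < u - s" using u(1) by (intro order_tendstoD(2)) auto
  then show "\<forall>\<^sub>F N in sequentially. dist (right_step t f N s) (f s) < e"
  proof eventually_elim
    case (elim N)
    obtain c where c: "s \<le> c" "c \<le> t" "c < s + t / real (Suc N)" "right_step t f N s = f c"
      by (rule right_step_eq[OF s])
    then show ?case using u(2)[of c] elim by simp
  qed
qed

lemma norm_right_step_le:
  assumes "0 \<le> t" "\<And>s. s \<in> {0..t} \<Longrightarrow> norm (f s) \<le> M"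
  shows "norm (right_step t f N s) \<le> M"
proof (cases "s \<in> {0<..t}")
  case True
  then obtain c where "s \<le> c" "c \<le> t" "right_step t f N s = f c" by (rule right_step_eq)
  then show ?thesis using assms(2)[of c] True by auto
next
  case False
  then show ?thesis
    using right_step_zero[OF False assms(1), of f N] order_trans[OF norm_ge_zero assms(2)[of 0]] assms(1) by simp
qed

text \<open>The sums are exact integrals of the functions \<open>right_step t f N\<close>, since the
  measure of a cell is the increment of \<open>F\<close> over it. Dominated convergence with the
  bound \<open>M\<close> on (0,t] applies, and measurability of \<open>f\<close> on (0,t] comes from
  the same pointwise limit.\<close>

lemma right_sum_tendsto_interval_measure:
  fixes f F :: "real \<Rightarrow> real"
  assumes t: "0 < t" and F: "\<And>x y. x \<le> y \<Longrightarrow> F x \<le> F y" "\<And>x. continuous (at_right x) F"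
    and f: "\<And>s. s \<in> {0..<t} \<Longrightarrow> (f \<longlongrightarrow> f s) (at_right s)" and M: "\<And>s. s \<in> {0..t} \<Longrightarrow> \<bar>f s\<bar> \<le> M"
  shows "right_sum t f F \<longlonglongrightarrow> (LINT s:{0<..t}|interval_measure F. f s)"
proof -
  let ?M = "interval_measure F"
  have meas: "emeasure ?M {x<..y} < \<infinity>" for x y
    using emeasure_interval_measure_Ioc_eq[of F x y, OF F] by (simp add: less_top[symmetric])
  have int: "integrable ?M (indicator {x<..y} :: real \<Rightarrow> real)" for x y
    using meas[of x y] by (intro integrable_real_indicator) auto
  have eq: "integral\<^sup>L ?M (right_step t f N) = right_sum t f F N" for N
  proof -
    have "integral\<^sup>L ?M (right_step t f N) =
        (\<Sum>i<Suc N. integral\<^sup>L ?M (\<lambda>s. indicator {grid t N i<..grid t N (Suc i)} s *\<^sub>R f (grid t N (Suc i))))"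
      unfolding right_step_def[abs_def] by (intro Bochner_Integration.integral_sum) (use int in auto)
    also have "\<dots> = (\<Sum>i<Suc N. (F (grid t N (Suc i)) - F (grid t N i)) * f (grid t N (Suc i)))"
    proof (intro sum.cong refl)
      fix i
      have "measure ?M {grid t N i<..grid t N (Suc i)} = F (grid t N (Suc i)) - F (grid t N i)"
        using t by (intro measure_interval_measure_Ioc F grid_mono) auto
      then show "integral\<^sup>L ?M (\<lambda>s. indicator {grid t N i<..grid t N (Suc i)} s *\<^sub>R f (grid t N (Suc i))) =
          (F (grid t N (Suc i)) - F (grid t N i)) * f (grid t N (Suc i))"
        using meas[of "grid t N i" "grid t N (Suc i)"] by (simp add: less_top[symmetric])
    qed
    finally show ?thesis by (simp add: right_sum_def mult.commute)
  qed
  have lim: "(\<lambda>N. right_step t f N s) \<longlonglongrightarrow> indicator {0<..t} s *\<^sub>R f s" for s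
  proof (cases "s \<in> {0<..t}")
    case True
    then show ?thesis using right_step_tendsto[OF True, of f] f[of s] by auto
  next
    case False
    then show ?thesis using right_step_zero[OF False, of f] t by simp
  qed
  have bm: "right_step t f N \<in> borel_measurable ?M" for N
    unfolding right_step_def[abs_def] by measurable
  have bm': "(\<lambda>s. indicator {0<..t} s *\<^sub>R f s) \<in> borel_measurable ?M"
    by (rule borel_measurable_LIMSEQ_real[OF lim bm])
  have "(\<lambda>N. integral\<^sup>L ?M (right_step t f N)) \<longlonglongrightarrow> integral\<^sup>L ?M (\<lambda>s. indicator {0<..t} s *\<^sub>R f s)"
  proof (rule integral_dominated_convergence[where w = "\<lambda>s. M * indicator {0<..t} s"])
    show "integrable ?M (\<lambda>s. M * indicator {0<..t} s)" by (intro integrable_mult_right int)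
    have "norm (right_step t f N s) \<le> M * indicator {0<..t} s" for N s
      using norm_right_step_le[of t f M N s] M t right_step_zero[of s t f N] by (cases "s \<in> {0<..t}") auto
    then show "AE s in ?M. norm (right_step t f N s) \<le> M * indicator {0<..t} s" for N by simp
  qed (use lim bm bm' in auto)
  then show ?thesis unfolding eq set_lebesgue_integral_def .
qed

lemma right_sum_tendsto_LS_integral:
  fixes f g :: "real \<Rightarrow> real"
  assumes t: "0 \<le> t" "t \<le> T" and fv: "finite_variation T g"
    and g: "\<And>s. s \<in> {0..<T} \<Longrightarrow> (g \<longlongrightarrow> g s) (at_right s)"
    and f: "\<And>s. s \<in> {0..<T} \<Longrightarrow> (f \<longlongrightarrow> f s) (at_right s)" and M: "\<And>s. s \<in> {0..T} \<Longrightarrow> \<bar>f s\<bar> \<le> M"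
  shows "right_sum t f g \<longlonglongrightarrow> LS_integral t f g"
proof (cases "t = 0")
  case True
  then show ?thesis
    by (simp add: LS_integral_def right_sum_def[abs_def] grid_def set_lebesgue_integral_def)
next
  case False
  then have t0: "0 < t" using t by simp
  \<comment> \<open>Clamping time to [0,t] turns the variation and its difference with
    \<open>g\<close> into nondecreasing right-continuous functions on the whole line, as
    \<open>interval_measure\<close> expects.\<close>
  define c where "c s = max 0 (min s t)" for s
  define F where "F s = total_variation g (c s)" for s
  define G where "G s = F s - g (c s)" for s
  have c: "0 \<le> c s" "c s \<le> T" "x \<le> y \<Longrightarrow> c x \<le> c y" for s x y using t by (auto simp: c_def)
  have diff: "\<bar>g (c y) - g (c x)\<bar> \<le> F y - F x" if "x \<le> y" for x y
    using norm_diff_le_total_variation_diff[OF fv c(1) c(3)[OF that] c(2)] by (simp add: F_def)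
  have mono: "F x \<le> F y" "G x \<le> G y" if "x \<le> y" for x y
    using diff[OF that] by (auto simp: G_def)
  \<comment> \<open>Outside [0,t) the clamped time is constant on a right neighbourhood, so
    continuity from the right is immediate there.\<close>
  have const: "(h \<longlongrightarrow> h x) (at_right x)"
    if "x < 0 \<or> t \<le> x" "\<And>s. h s = h' (c s)" for h h' :: "real \<Rightarrow> real" and x
  proof -
    define b where "b = (if x < 0 then 0 else x + 1)"
    have "b > x" "\<And>s. x < s \<Longrightarrow> s < b \<Longrightarrow> c s = c x" using that(1) t by (auto simp: b_def c_def)
    then have "\<forall>\<^sub>F s in at_right x. h s = h x"
      unfolding eventually_at_right[OF \<open>b > x\<close>] using that(2) by (intro exI[of _ b]) auto
    then show ?thesis by (rule tendsto_eventually)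
  qed
  have gc: "((\<lambda>s. g (c s)) \<longlongrightarrow> g (c x)) (at_right x)" for x
  proof (cases "x < 0 \<or> t \<le> x")
    case True
    then show ?thesis using const[of x "\<lambda>s. g (c s)" g] by simp
  next
    case False
    then have xt: "x < t" by auto
    have "\<forall>\<^sub>F s in at_right x. g s = g (c s)"
      unfolding eventually_at_right[OF xt] using False by (intro exI[of _ t]) (auto simp: c_def)
    moreover have "g x = g (c x)" using False by (auto simp: c_def)
    ultimately show ?thesis using g[of x] False t tendsto_cong[of g "\<lambda>s. g (c s)"] by auto
  qed
  have Fc: "(F \<longlongrightarrow> F x) (at_right x)" for x
  proof (cases "x < 0 \<or> t \<le> x")
    case True
    then show ?thesis using const[of x F "total_variation g"] by (simp add: F_def)
  next
    case False
    then have x: "0 \<le> x" "x < t" "x < T" using t by auto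
    show ?thesis
    proof (rule tendstoI)
      fix e :: real assume "e > 0"
      then obtain u where u: "u > x" "\<And>s. x < s \<Longrightarrow> s < u \<Longrightarrow> s \<le> T \<Longrightarrow> total_variation g s \<le> total_variation g x + e / 2"
        using total_variation_right_bound[OF fv x(1,3), of "e / 2"] g[of x] x by auto
      have "dist (F s) (F x) < e" if s: "x < s" "s < min u t" for s
      proof -
        have "F s \<le> F x + e / 2" using u(2)[of s] s x t by (simp add: F_def c_def)
        then show ?thesis using mono(1)[of x s] s \<open>e > 0\<close> by (simp add: dist_real_def)
      qed
      then show "\<forall>\<^sub>F s in at_right x. dist (F s) (F x) < e"
        unfolding eventually_at_right[OF x(2)] using u(1) x(2) by (intro exI[of _ "min u t"]) auto
    qed
  qed
  have cont: "continuous (at_right x) F" "continuous (at_right x) G" for x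
    using tendsto_diff[OF Fc gc, of x] Fc[of x] by (auto simp: continuous_within G_def[abs_def])
  have f': "s \<in> {0..<t} \<Longrightarrow> (f \<longlongrightarrow> f s) (at_right s)" "s \<in> {0..t} \<Longrightarrow> \<bar>f s\<bar> \<le> M" for s
    using f M t by auto
  have "(\<lambda>N. right_sum t f F N - right_sum t f G N) \<longlonglongrightarrow>
      (LINT s:{0<..t}|interval_measure F. f s) - (LINT s:{0<..t}|interval_measure G. f s)"
    by (intro tendsto_diff right_sum_tendsto_interval_measure[where M = M] t0 mono cont f')
  \<comment> \<open>Grid points lie in [0,t], where clamping is the identity, so the increments of
    \<open>F\<close> and \<open>G\<close> differ by exactly those of \<open>g\<close>.\<close>
  moreover have "right_sum t f F N - right_sum t f G N = right_sum t f g N" for N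
    unfolding right_sum_def sum_subtractf[symmetric]
  proof (intro sum.cong refl)
    fix i assume "i \<in> {..<Suc N}"
    then have "c (grid t N i) = grid t N i" "c (grid t N (Suc i)) = grid t N (Suc i)"
      using grid_in[OF t(1), of i N] grid_in[OF t(1), of "Suc i" N] by (auto simp: c_def)
    then show "f (grid t N (Suc i)) \<bullet> (F (grid t N (Suc i)) - F (grid t N i)) -
        f (grid t N (Suc i)) \<bullet> (G (grid t N (Suc i)) - G (grid t N i)) =
        f (grid t N (Suc i)) \<bullet> (g (grid t N (Suc i)) - g (grid t N i))"
      by (simp add: G_def algebra_simps)
  qed
  ultimately show ?thesis
    by (simp add: LS_integral_def F_def[abs_def] G_def[abs_def] c_def[abs_def])
qed

lemma finite_variation_inner:
  assumes "finite_variation T k" "norm b \<le> 1"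
  shows "finite_variation T (\<lambda>s. k s \<bullet> b)"
proof -
  obtain M where M: "\<And>v. v \<in> variation_sums k T \<Longrightarrow> v \<le> M"
    using assms(1) by (auto simp: finite_variation_def bdd_above_def)
  show ?thesis unfolding finite_variation_def
  proof (rule bdd_aboveI)
    fix v assume "v \<in> variation_sums (\<lambda>s. k s \<bullet> b) T"
    then obtain p n where p: "v = (\<Sum>i<n. norm (k (p (Suc i)) \<bullet> b - k (p i) \<bullet> b))" "p 0 = 0" "p n = T"
      "\<forall>i<n. p i \<le> p (Suc i)" by (auto simp: variation_sums_def)
    have "norm (x \<bullet> b - y \<bullet> b) \<le> norm (x - y)" for x y
    proof -
      have "norm (x \<bullet> b - y \<bullet> b) \<le> norm (x - y) * norm b"
        using Cauchy_Schwarz_ineq2[of "x - y" b] by (simp add: inner_diff_left)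
      then show ?thesis using mult_left_mono[OF assms(2) norm_ge_zero[of "x - y"]] by simp
    qed
    then have "v \<le> (\<Sum>i<n. norm (k (p (Suc i)) - k (p i)))" unfolding p(1) by (intro sum_mono)
    also have "\<dots> \<le> M" by (rule M) (use p in \<open>auto simp: variation_sums_def\<close>)
    finally show "v \<le> M" .
  qed
qed

lemma right_sum_tendsto_LS_inner_integral:
  fixes f k :: "real \<Rightarrow> 'a::euclidean_space"
  assumes t: "0 < T" "0 \<le> t" "t \<le> T" and fv: "finite_variation T k" and k: "cadlag_on T k" and f: "cadlag_on T f"
  shows "right_sum t f k \<longlonglongrightarrow> LS_inner_integral t f k"
proof -
  obtain M where M: "\<And>t. t \<in> {0..T} \<Longrightarrow> norm (f t) \<le> M" using cadlag_bounded[OF t(1) f] by blast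
  have eq: "right_sum t f k N = (\<Sum>b\<in>Basis. right_sum t (\<lambda>s. f s \<bullet> b) (\<lambda>s. k s \<bullet> b) N)" for N
    unfolding right_sum_def
  proof (subst sum.swap, rule sum.cong[OF refl])
    fix i
    show "f (grid t N (Suc i)) \<bullet> (k (grid t N (Suc i)) - k (grid t N i)) =
        (\<Sum>b\<in>Basis. (f (grid t N (Suc i)) \<bullet> b) \<bullet> (k (grid t N (Suc i)) \<bullet> b - k (grid t N i) \<bullet> b))"
      by (subst euclidean_inner) (simp add: inner_diff_left)
  qed
  have "(\<lambda>N. \<Sum>b\<in>Basis. right_sum t (\<lambda>s. f s \<bullet> b) (\<lambda>s. k s \<bullet> b) N) \<longlonglongrightarrow> LS_inner_integral t f k"
    unfolding LS_inner_integral_def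
  proof (intro tendsto_sum right_sum_tendsto_LS_integral[OF t(2,3)])
    fix b :: 'a assume b: "b \<in> Basis"
    show "finite_variation T (\<lambda>s. k s \<bullet> b)" using finite_variation_inner[OF fv] b by simp
    show "((\<lambda>s. k s \<bullet> b) \<longlongrightarrow> k s \<bullet> b) (at_right s)" if "s \<in> {0..<T}" for s
      using k that by (intro tendsto_inner tendsto_const) (auto simp: cadlag_on_def)
    show "((\<lambda>s. f s \<bullet> b) \<longlongrightarrow> f s \<bullet> b) (at_right s)" if "s \<in> {0..<T}" for s
      using f that by (intro tendsto_inner tendsto_const) (auto simp: cadlag_on_def)
    show "\<bar>f s \<bullet> b\<bar> \<le> M" if "s \<in> {0..T}" for s
      using Basis_le_norm[OF b, of "f s"] M[OF that] by linarith
  qed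
  then show ?thesis unfolding eq[abs_def] by simp
qed

section \<open>Sums of cadlag functions and estimates for right-endpoint sums\<close>

lemma cadlag_on_add:
  fixes f g :: "real \<Rightarrow> 'a::real_normed_vector"
  assumes "cadlag_on T f" "cadlag_on T g"
  shows "cadlag_on T (\<lambda>s. f s + g s)"
  unfolding cadlag_on_def
proof (intro conjI ballI)
  fix t assume "t \<in> {0..<T}"
  then show "((\<lambda>s. f s + g s) \<longlongrightarrow> f t + g t) (at_right t)"
    using assms unfolding cadlag_on_def by (intro tendsto_add) blast+
next
  fix t assume t: "t \<in> {0<..T}"
  obtain l where "(f \<longlongrightarrow> l) (at_left t)" using assms(1) t unfolding cadlag_on_def by blast
  moreover obtain m where "(g \<longlongrightarrow> m) (at_left t)" using assms(2) t unfolding cadlag_on_def by blast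
  ultimately show "\<exists>l. ((\<lambda>s. f s + g s) \<longlongrightarrow> l) (at_left t)" using tendsto_add by blast
qed

lemma cadlag_on_minus:
  fixes f :: "real \<Rightarrow> 'a::real_normed_vector"
  shows "cadlag_on T f \<Longrightarrow> cadlag_on T (\<lambda>s. - f s)"
  unfolding cadlag_on_def by (blast intro: tendsto_minus)

lemma cadlag_on_diff:
  fixes f g :: "real \<Rightarrow> 'a::real_normed_vector"
  shows "cadlag_on T f \<Longrightarrow> cadlag_on T g \<Longrightarrow> cadlag_on T (\<lambda>s. f s - g s)"
  using cadlag_on_add[OF _ cadlag_on_minus, of T f g] by simp

lemma right_sum_cong:
  assumes "0 \<le> t" "\<And>s. s \<in> {0..t} \<Longrightarrow> f s = f' s" "\<And>s. s \<in> {0..t} \<Longrightarrow> k s = k' s"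
  shows "right_sum t f k N = right_sum t f' k' N"
  unfolding right_sum_def
proof (intro sum.cong refl)
  fix i assume "i \<in> {..<Suc N}"
  then have "grid t N i \<in> {0..t}" "grid t N (Suc i) \<in> {0..t}" by (intro grid_in assms; simp)+
  then show "f (grid t N (Suc i)) \<bullet> (k (grid t N (Suc i)) - k (grid t N i)) =
      f' (grid t N (Suc i)) \<bullet> (k' (grid t N (Suc i)) - k' (grid t N i))"
    using assms by simp
qed

lemma right_sum_diff_left:
  "right_sum t (\<lambda>s. f s - g s) k N = right_sum t f k N - right_sum t g k N"
  unfolding right_sum_def sum_subtractf[symmetric] by (simp add: inner_diff_left)

lemma right_sum_diff_right:
  "right_sum t f (\<lambda>s. k s - l s) N = right_sum t f k N - right_sum t f l N"
  unfolding right_sum_def sum_subtractf[symmetric] by (simp add: inner_diff_right algebra_simps)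

text \<open>One-sided integration by parts: for consecutive values v, w of \<open>u\<close>, the
  pairing of w with w - v exceeds (|w|^2 - |v|^2) / 2 by |w - v|^2 / 2, and the rest
  telescopes.\<close>

lemma right_sum_self_ge:
  "((norm (u t))\<^sup>2 - (norm (u 0))\<^sup>2) / 2 \<le> right_sum t u u N"
proof -
  let ?g = "\<lambda>i. (norm (u (grid t N i)))\<^sup>2 / 2"
  have "?g (Suc i) - ?g i \<le> u (grid t N (Suc i)) \<bullet> (u (grid t N (Suc i)) - u (grid t N i))" for i
    using zero_le_power2[of "norm (u (grid t N (Suc i)) - u (grid t N i))"]
    by (simp add: power2_norm_eq_inner inner_diff_left inner_diff_right inner_commute)
  then have "(\<Sum>i<Suc N. ?g (Suc i) - ?g i) \<le> right_sum t u u N"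
    unfolding right_sum_def by (intro sum_mono)
  then show ?thesis unfolding sum_lessThan_telescope[of ?g] by (simp add: diff_divide_distrib)
qed

lemma abs_right_sum_le:
  assumes "0 \<le> t" "\<And>s. s \<in> {0..t} \<Longrightarrow> norm (f s) \<le> e" "\<And>v. v \<in> variation_sums k t \<Longrightarrow> v \<le> V"
  shows "\<bar>right_sum t f k N\<bar> \<le> e * V"
proof -
  have e: "0 \<le> e" using order_trans[OF norm_ge_zero assms(2)[of 0]] assms(1) by simp
  have "\<bar>right_sum t f k N\<bar> \<le> (\<Sum>i<Suc N. e * norm (k (grid t N (Suc i)) - k (grid t N i)))"
    unfolding right_sum_def
  proof (rule sum_norm_le[of _ "\<lambda>i. f (grid t N (Suc i)) \<bullet> (k (grid t N (Suc i)) - k (grid t N i))", unfolded real_norm_def])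
    fix i assume "i \<in> {..<Suc N}"
    then have "grid t N (Suc i) \<in> {0..t}" by (intro grid_in assms) auto
    then show "\<bar>f (grid t N (Suc i)) \<bullet> (k (grid t N (Suc i)) - k (grid t N i))\<bar>
        \<le> e * norm (k (grid t N (Suc i)) - k (grid t N i))"
      by (intro order_trans[OF Cauchy_Schwarz_ineq2] mult_right_mono assms) auto
  qed
  also have "\<dots> = e * (\<Sum>i<Suc N. norm (k (grid t N (Suc i)) - k (grid t N i)))" by (rule sum_distrib_left[symmetric])
  also have "\<dots> \<le> e * V"
  proof (intro mult_left_mono e assms(3))
    show "(\<Sum>i<Suc N. norm (k (grid t N (Suc i)) - k (grid t N i))) \<in> variation_sums k t"
      unfolding variation_sums_def
      by (rule CollectI, intro exI[of _ "grid t N"] exI[of _ "Suc N"]) (use assms in \<open>simp add: grid_mono\<close>)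
  qed
  finally show ?thesis .
qed

text \<open>The selected indices form a final segment starting at some \<open>m\<close>, so the sum
  telescopes; \<open>m = n\<close> covers the empty segment.\<close>

lemma telescope_upward_closed:
  fixes g :: "nat \<Rightarrow> 'a::ab_group_add"
  assumes "\<And>i j. i \<le> j \<Longrightarrow> P i \<Longrightarrow> P j"
  shows "\<exists>m\<le>n. (\<Sum>i\<in>{i\<in>{..<n}. P i}. g (Suc i) - g i) = g n - g m"
proof (induction n)
  case (Suc n)
  show ?case
  proof (cases "P n")
    case True
    have "{i\<in>{..<Suc n}. P i} = insert n {i\<in>{..<n}. P i}" using True by auto
    then have "(\<Sum>i\<in>{i\<in>{..<Suc n}. P i}. g (Suc i) - g i) =
        (g (Suc n) - g n) + (\<Sum>i\<in>{i\<in>{..<n}. P i}. g (Suc i) - g i)" by simp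
    moreover obtain m where "m \<le> n" "(\<Sum>i\<in>{i\<in>{..<n}. P i}. g (Suc i) - g i) = g n - g m"
      using Suc.IH by blast
    ultimately show ?thesis by (intro exI[of _ m]) simp
  next
    case False
    then have empty: "{i\<in>{..<Suc n}. P i} = {}" using assms by (auto simp: less_Suc_eq_le)
    show ?thesis unfolding empty by (intro exI[of _ "Suc n"]) simp
  qed
qed simp

text \<open>Counterpart of \<open>abs_right_sum_le\<close> with the roles exchanged: for a step
  integrand the sum is controlled by the supremum of the integrator instead of its variation,
  uniformly in \<open>N\<close>. The factor 2 comes from the tail sums, which telescope to a
  difference of two values of \<open>u\<close>.\<close>

lemma abs_right_sum_jump_fun_le:
  assumes "finite B" "0 \<le> t" "\<And>s. s \<in> {0..t} \<Longrightarrow> norm (u s) \<le> K"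
  shows "\<bar>right_sum t (jump_fun B \<gamma>) u N\<bar> \<le> 2 * K * (\<Sum>b\<in>B. norm (\<gamma> b))"
  unfolding right_sum_def
proof (rule sum_jump_fun_inner_le[OF assms(1), where q = "\<lambda>i. grid t N (Suc i)"])
  fix b
  have up: "b \<le> grid t N (Suc j)" if "i \<le> j" "b \<le> grid t N (Suc i)" for i j
    using grid_mono[OF assms(2), of "Suc i" "Suc j" N] that by simp
  have "\<exists>m\<le>Suc N. (\<Sum>i\<in>{i\<in>{..<Suc N}. b \<le> grid t N (Suc i)}. u (grid t N (Suc i)) - u (grid t N i)) =
      u (grid t N (Suc N)) - u (grid t N m)"
    by (rule telescope_upward_closed[where g = "\<lambda>i. u (grid t N i)"]) (rule up)
  then obtain m where m: "m \<le> Suc N" "(\<Sum>i\<in>{i\<in>{..<Suc N}. b \<le> grid t N (Suc i)}. u (grid t N (Suc i)) - u (grid t N i)) =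
      u t - u (grid t N m)" by auto
  have "norm (u t) \<le> K" "norm (u (grid t N m)) \<le> K" using assms(2) grid_in[OF assms(2) m(1)] by (intro assms(3); simp)+
  then show "norm (\<Sum>i\<in>{i\<in>{..<Suc N}. b \<le> grid t N (Suc i)}. u (grid t N (Suc i)) - u (grid t N i)) \<le> 2 * K"
    unfolding m(2) using norm_triangle_ineq4[of "u t" "u (grid t N m)"] by linarith
qed simp

lemma right_sum_jump_fun_integrator:
  fixes f :: "real \<Rightarrow> 'a::real_inner"
  assumes "finite A" "0 \<le> t"
  shows "right_sum t f (jump_fun A d) N = (\<Sum>s\<in>A. right_step t f N s \<bullet> d s)"
proof -
  have "right_sum t f (jump_fun A d) N =
      (\<Sum>i<Suc N. \<Sum>s\<in>A. indicator {grid t N i<..grid t N (Suc i)} s * (f (grid t N (Suc i)) \<bullet> d s))"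
    unfolding right_sum_def
  proof (rule sum.cong[OF refl])
    fix i
    have "jump_fun A d (grid t N (Suc i)) - jump_fun A d (grid t N i) =
        sum d (A \<inter> {grid t N i<..grid t N (Suc i)})"
      using grid_mono[OF assms(2), of i "Suc i" N] by (intro jump_fun_diff assms) simp
    also have "\<dots> = (\<Sum>s\<in>A. indicator {grid t N i<..grid t N (Suc i)} s *\<^sub>R d s)"
      by (subst sum.inter_restrict[OF assms(1)]) (auto intro!: sum.cong simp: indicator_def)
    finally show "f (grid t N (Suc i)) \<bullet> (jump_fun A d (grid t N (Suc i)) - jump_fun A d (grid t N i)) =
        (\<Sum>s\<in>A. indicator {grid t N i<..grid t N (Suc i)} s * (f (grid t N (Suc i)) \<bullet> d s))"
      by (simp add: inner_sum_right)
  qed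
  also have "\<dots> = (\<Sum>s\<in>A. \<Sum>i<Suc N. indicator {grid t N i<..grid t N (Suc i)} s * (f (grid t N (Suc i)) \<bullet> d s))"
    by (rule sum.swap)
  also have "\<dots> = (\<Sum>s\<in>A. right_step t f N s \<bullet> d s)"
    unfolding right_step_def inner_sum_left inner_scaleR_left ..
  finally show ?thesis .
qed

lemma right_sum_jump_fun_tendsto:
  fixes f :: "real \<Rightarrow> 'a::real_inner"
  assumes "finite A" "0 \<le> t" and f: "\<And>s. s \<in> {0..<t} \<Longrightarrow> (f \<longlongrightarrow> f s) (at_right s)"
  shows "right_sum t f (jump_fun A d) \<longlonglongrightarrow> (\<Sum>s\<in>A \<inter> {0<..t}. f s \<bullet> d s)"
proof -
  have eq: "right_sum t f (jump_fun A d) N = (\<Sum>s\<in>A \<inter> {0<..t}. right_step t f N s \<bullet> d s)" for N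
    unfolding right_sum_jump_fun_integrator[OF assms(1,2)]
    by (rule sum.mono_neutral_right) (use assms right_step_zero[of _ t f N] in auto)
  show ?thesis unfolding eq[abs_def]
    by (intro tendsto_sum tendsto_inner right_step_tendsto tendsto_const) (use f in auto)
qed

lemma variation_sums_jump_fun_le:
  assumes "finite A" "0 \<le> t" "v \<in> variation_sums (jump_fun A d) t"
  shows "v \<le> (\<Sum>s\<in>A. norm (d s))"
proof -
  let ?G = "jump_fun A (\<lambda>s. norm (d s))"
  have "v \<le> ?G t - ?G 0"
    by (rule variation_sums_le[OF _ assms(3)]) (rule norm_jump_fun_diff_le[OF assms(1)])
  moreover have "?G t \<le> (\<Sum>s\<in>A. norm (d s))" "0 \<le> ?G 0"
    unfolding jump_fun_def using assms(1) by (auto intro!: sum_mono2 sum_nonneg)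
  ultimately show ?thesis by linarith
qed

text \<open>Replacing \<open>k\<close> by its approximation changes the Riemann sums uniformly in the mesh, so the
  two limits can be interchanged.\<close>

lemma integral_limit_nonpos:
  fixes f k :: "real \<Rightarrow> 'a::euclidean_space"
  assumes T: "0 < T" and t: "t \<in> {0..T}" and f: "cadlag_on T f" and V: "0 \<le> V"
    and k: "\<And>v. v \<in> variation_sums k t \<Longrightarrow> v \<le> V"
    and A: "\<And>n. finite (A n)" "\<And>n. (\<Sum>s\<in>A n. norm (d n s)) \<le> V"
    and close: "\<And>n s. norm (k s - jump_fun (A n) (d n) s) \<le> \<eta> n" and \<eta>: "\<eta> \<longlonglongrightarrow> 0"
    and J: "\<And>n. (\<Sum>s\<in>A n \<inter> {0<..t}. f s \<bullet> d n s) \<le> \<eta> n * V"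
    and L: "right_sum t f k \<longlonglongrightarrow> L"
  shows "L \<le> 0"
proof (rule field_le_epsilon)
  fix e' :: real assume "e' > 0"
  \<comment> \<open>Chosen to make \<open>2 * e * V\<close> at most \<open>e'\<close>; the added 1
    keeps the denominator positive when \<open>V = 0\<close>.\<close>
  define e where "e = e' / (2 * V + 1)"
  have e: "e > 0" "2 * e * V \<le> e'" using \<open>e' > 0\<close> V by (auto simp: e_def field_simps)
  obtain B \<gamma> where B: "finite B" "\<And>t. t \<in> {0..T} \<Longrightarrow> norm (f t - jump_fun B \<gamma> t) \<le> e"
    by (rule cadlag_approx_jump_fun[OF T e(1) f]) blast
  define G where "G = (\<Sum>b\<in>B. norm (\<gamma> b))"
  have t0: "0 \<le> t" using t by simp
  have "L \<le> 2 * e * V + 2 * \<eta> n * G + \<eta> n * V" for n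
  proof -
    let ?k = "jump_fun (A n) (d n)" and ?g = "jump_fun B \<gamma>"
    have "right_sum t f k N \<le> 2 * e * V + 2 * \<eta> n * G + right_sum t f ?k N" for N
    proof -
      \<comment> \<open>The integrand error \<open>f - ?g\<close> is small uniformly and meets
        integrators of variation at most \<open>V\<close>; the uniformly small integrator error
        \<open>k - ?k\<close> meets only the step function \<open>?g\<close>.\<close>
      have "right_sum t f k N - right_sum t f ?k N = right_sum t (\<lambda>s. f s - ?g s) k N -
          right_sum t (\<lambda>s. f s - ?g s) ?k N + right_sum t ?g (\<lambda>s. k s - ?k s) N"
        by (simp add: right_sum_diff_left right_sum_diff_right)
      moreover have "\<bar>right_sum t (\<lambda>s. f s - ?g s) k N\<bar> \<le> e * V"
        by (rule abs_right_sum_le[OF t0 _ k]) (use B t in auto)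
      moreover have "\<bar>right_sum t (\<lambda>s. f s - ?g s) ?k N\<bar> \<le> e * V"
        by (rule abs_right_sum_le[OF t0 _ order_trans[OF variation_sums_jump_fun_le[OF A(1) t0] A(2)]])
          (use B t in auto)
      moreover have "\<bar>right_sum t ?g (\<lambda>s. k s - ?k s) N\<bar> \<le> 2 * \<eta> n * G"
        unfolding G_def by (rule abs_right_sum_jump_fun_le[OF B(1) t0]) (rule close)
      ultimately show ?thesis by linarith
    qed
    moreover have "(\<lambda>N. 2 * e * V + 2 * \<eta> n * G + right_sum t f ?k N) \<longlonglongrightarrow>
        2 * e * V + 2 * \<eta> n * G + (\<Sum>s\<in>A n \<inter> {0<..t}. f s \<bullet> d n s)"
      using f t by (intro tendsto_add tendsto_const right_sum_jump_fun_tendsto A t0) (auto simp: cadlag_on_def)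
    ultimately have "L \<le> 2 * e * V + 2 * \<eta> n * G + (\<Sum>s\<in>A n \<inter> {0<..t}. f s \<bullet> d n s)"
      using L by (intro LIMSEQ_le[OF L]) auto
    then show ?thesis using J[of n] by linarith
  qed
  moreover have "(\<lambda>n. 2 * e * V + 2 * \<eta> n * G + \<eta> n * V) \<longlonglongrightarrow> 2 * e * V + 2 * 0 * G + 0 * V"
    by (intro tendsto_intros \<eta>)
  ultimately have "L \<le> 2 * e * V + 2 * 0 * G + 0 * V" by (intro LIMSEQ_le_const) auto
  then show "L \<le> 0 + e'" using e by simp
qed

subsection \<open>The reflection problem\<close>

lemma reflection_solution_unique:
  fixes x x' k k' y :: "real \<Rightarrow> 'a::euclidean_space"
  assumes T: "0 < T" and t: "t \<in> {0..T}"
    and sol: "reflection_solution T D y x k" "reflection_solution T D y x' k'"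
  shows "x' t = x t \<and> k' t = k t"
proof -
  define u where "u s = k s - k' s" for s
  have c: "cadlag_on T x" "cadlag_on T x'" "cadlag_on T k" "cadlag_on T k'"
    and fv: "finite_variation T k" "finite_variation T k'" and k0: "k 0 = 0" "k' 0 = 0"
    and x: "\<And>s. s \<in> {0..T} \<Longrightarrow> x s = y s + k s" "\<And>s. s \<in> {0..T} \<Longrightarrow> x' s = y s + k' s"
    and D: "\<forall>s\<in>{0..T}. x s \<in> D s" "\<forall>s\<in>{0..T}. x' s \<in> D s"
    using sol by (auto simp: reflection_solution_def cadlag_space_def)
  \<comment> \<open>Each solution is an admissible test function for the other, and \<open>y\<close>
    cancels in the difference of the two.\<close>
  have le: "LS_inner_integral t (\<lambda>s. x s - x' s) k \<le> 0" "LS_inner_integral t (\<lambda>s. x' s - x s) k' \<le> 0"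
    using sol c D t unfolding reflection_solution_def by blast+
  have t': "0 \<le> t" "t \<le> T" using t by auto
  have "(\<lambda>N. right_sum t (\<lambda>s. x s - x' s) k N + right_sum t (\<lambda>s. x' s - x s) k' N) \<longlonglongrightarrow>
      LS_inner_integral t (\<lambda>s. x s - x' s) k + LS_inner_integral t (\<lambda>s. x' s - x s) k'"
    by (intro tendsto_add right_sum_tendsto_LS_inner_integral[OF T t'] fv c cadlag_on_diff)
  moreover have "(norm (u t))\<^sup>2 / 2 \<le> right_sum t (\<lambda>s. x s - x' s) k N + right_sum t (\<lambda>s. x' s - x s) k' N" for N
  proof -
    have "right_sum t u u N = right_sum t (\<lambda>s. x s - x' s) (\<lambda>s. k s - k' s) N"
      using x t by (intro right_sum_cong) (auto simp: u_def)
    then show ?thesis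
      using right_sum_self_ge[of u t N] k0 by (simp add: u_def right_sum_diff_left right_sum_diff_right)
  qed
  ultimately have "(norm (u t))\<^sup>2 / 2 \<le>
      LS_inner_integral t (\<lambda>s. x s - x' s) k + LS_inner_integral t (\<lambda>s. x' s - x s) k'"
    by (intro LIMSEQ_le_const) auto
  then have "(norm (u t))\<^sup>2 \<le> 0" using le by linarith
  then show ?thesis using x t by (simp add: u_def)
qed

text \<open>A ball is connected, so if it met both \<open>S\<close> and its complement it would
  contain a frontier point, at distance less than \<open>r\<close> from \<open>c\<close>.\<close>

lemma ball_infdist_frontier_subset:
  fixes c :: "'a::real_normed_vector"
  assumes "c \<in> S" "r \<le> infdist c (frontier S)"
  shows "ball c r \<subseteq> S"
proof (rule ccontr)
  assume n: "\<not> ball c r \<subseteq> S"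
  then have "r > 0" by (metis ball_empty empty_subsetI not_less)
  then have "c \<in> ball c r \<inter> S" using assms(1) by simp
  then have "ball c r \<inter> S \<noteq> {}" "ball c r - S \<noteq> {}" using n by blast+
  then obtain z where z: "z \<in> ball c r" "z \<in> frontier S"
    using connected_Int_frontier[OF connected_ball, of c r S] by auto
  then have "infdist c (frontier S) \<le> dist c z" by (intro infdist_le)
  then show False using z assms by simp
qed

lemma hausdorff_cadlag_partition:
  fixes y :: "real \<Rightarrow> 'a::real_normed_vector"
  assumes T: "0 < T" and e: "0 < e" and D: "cadlag_bodies T D" and DT: "hausdorff_tendsto D (D T) (at_left T)"
    and y: "y \<in> cadlag_space T"
  shows "\<exists>A. finite A \<and> A \<subseteq> {0..<T} \<and> (\<forall>t\<in>{0..T}. \<exists>s\<in>A. s \<le> t \<and> A \<inter> {s<..t} = {} \<and>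
    dist (y s) (y t) + hausdorff_dist (D s) (D t) \<le> e)"
proof (rule cadlag_partition_closed[OF T e])
  have conv: "D t \<in> convex_bodies" if "t \<in> {0..T}" for t using D that by (simp add: cadlag_bodies_def)
  note b = convex_bodiesD[OF conv]
  show "dist (y t) (y t) + hausdorff_dist (D t) (D t) = 0" if "t \<in> {0..T}" for t
    using b(4)[OF that] by (simp add: hausdorff_dist_refl)
  show "((\<lambda>s. dist (y t) (y s) + hausdorff_dist (D t) (D s)) \<longlongrightarrow> 0) (at_right t)" if t: "t \<in> {0..<T}" for t
  proof -
    have "(y \<longlongrightarrow> y t) (at_right t)" using y t by (simp add: cadlag_space_def cadlag_on_def)
    then have "((\<lambda>s. dist (y t) (y s)) \<longlongrightarrow> dist (y t) (y t)) (at_right t)" by (intro tendsto_dist tendsto_const)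
    moreover have "((\<lambda>s. hausdorff_dist (D t) (D s)) \<longlongrightarrow> 0) (at_right t)"
      using D t by (subst hausdorff_dist_commute) (simp add: cadlag_bodies_def hausdorff_tendsto_def)
    ultimately show ?thesis using tendsto_add by force
  qed
  show "((\<lambda>s. dist (y s) (y T) + hausdorff_dist (D s) (D T)) \<longlongrightarrow> 0) (at_left T)"
  proof -
    have "(y \<longlongrightarrow> y T) (at_left T)" using y by (simp add: cadlag_space_def)
    then have "((\<lambda>s. dist (y s) (y T)) \<longlongrightarrow> dist (y T) (y T)) (at_left T)" by (intro tendsto_dist tendsto_const)
    then show ?thesis using tendsto_add[OF _ DT[unfolded hausdorff_tendsto_def]] by force
  qed
  show "dist (y s) (y u) + hausdorff_dist (D s) (D u) \<le>
      dist (y s) (y t) + hausdorff_dist (D s) (D t) + (dist (y t) (y u) + hausdorff_dist (D t) (D u))"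
    if "0 \<le> s" "s \<le> t" "t \<le> u" "u \<le> T" for s t u
  proof -
    have "s \<in> {0..T}" "t \<in> {0..T}" "u \<in> {0..T}" using that by auto
    then have "hausdorff_dist (D s) (D u) \<le> hausdorff_dist (D s) (D t) + hausdorff_dist (D t) (D u)"
      by (intro hausdorff_dist_triangle b)
    then show ?thesis using dist_triangle[of "y s" "y u" "y t"] by linarith
  qed
  show "\<exists>u<t. \<forall>s\<in>{u<..<t}. \<forall>s'\<in>{u<..<t}. 0 \<le> s \<longrightarrow> s \<le> s' \<longrightarrow>
      dist (y s) (y s') + hausdorff_dist (D s) (D s') \<le> e" if t: "t \<in> {0<..T}" and e: "0 < e" for t e
  proof -
    obtain l where l: "(y \<longlongrightarrow> l) (at_left t)" using y t unfolding cadlag_space_def cadlag_on_def by blast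
    \<comment> \<open>The left limit is a convex body, so the triangle inequality can pass through
      it. The bound \<open>e / 4\<close> is for the four distances to the limits \<open>l\<close>
      and \<open>L\<close> at \<open>s\<close> and \<open>s'\<close>.\<close>
    obtain L where L: "L \<in> convex_bodies" "hausdorff_tendsto D L (at_left t)"
      using D t unfolding cadlag_bodies_def by blast
    note bL = convex_bodiesD[OF L(1)]
    obtain u where u: "u < t" "\<forall>s\<in>{u<..<t}. dist (y s) l \<le> e / 4"
      using left_limit_dist_le[OF l, of "e / 4"] e by auto
    obtain v where v: "v < t" "\<forall>s\<in>{v<..<t}. dist (hausdorff_dist (D s) L) 0 \<le> e / 4"
      using left_limit_dist_le[OF L(2)[unfolded hausdorff_tendsto_def], of "e / 4"] e by auto
    have "dist (y s) (y s') + hausdorff_dist (D s) (D s') \<le> e"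
      if "s \<in> {max u v<..<t}" "s' \<in> {max u v<..<t}" "0 \<le> s" "s \<le> s'" for s s'
    proof -
      have "s \<in> {0..T}" "s' \<in> {0..T}" using that t by auto
      then have "hausdorff_dist (D s) (D s') \<le> hausdorff_dist (D s) L + hausdorff_dist L (D s')"
        by (intro hausdorff_dist_triangle b bL)
      moreover have "\<bar>hausdorff_dist (D s) L\<bar> \<le> e / 4" "\<bar>hausdorff_dist (D s') L\<bar> \<le> e / 4" using v that by auto
      moreover have "dist (y s) l \<le> e / 4" "dist (y s') l \<le> e / 4" using u that by auto
      ultimately show ?thesis
        using dist_triangle2[of "y s" "y s'" l] hausdorff_dist_commute[of L "D s'"] by linarith
    qed
    then show ?thesis using u(1) v(1) by (intro exI[of _ "max u v"]) auto
  qed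
qed

text \<open>Between two partition times the scheme is frozen at a point of the earlier set, so it
  can leave the current set only by what \<open>y\<close> and \<open>D\<close> have moved since,
  which is at most \<open>e\<close> in total.\<close>

lemma approximate_solution_exists:
  fixes y :: "real \<Rightarrow> 'a::euclidean_space"
  assumes T: "0 < T" and e: "0 < e" and D: "cadlag_bodies T D" and DT: "hausdorff_tendsto D (D T) (at_left T)"
    and y: "y \<in> cadlag_space T" and y0: "y 0 \<in> D 0"
  shows "\<exists>A d. finite A \<and> A \<subseteq> {0<..<T} \<and>
    (\<forall>s\<in>A. \<forall>w\<in>D s. (y s + jump_fun A d s - w) \<bullet> d s \<le> 0) \<and>
    (\<forall>t\<in>{0..T}. infdist (y t + jump_fun A d t) (D t) \<le> e)"
proof -
  have conv: "D t \<in> convex_bodies" if "t \<in> {0..T}" for t using D that by (simp add: cadlag_bodies_def)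
  note b = convex_bodiesD[OF conv]
  obtain A where A: "finite A" "A \<subseteq> {0..<T}" and P: "\<forall>t\<in>{0..T}. \<exists>s\<in>A. s \<le> t \<and> A \<inter> {s<..t} = {} \<and>
      dist (y s) (y t) + hausdorff_dist (D s) (D t) \<le> e"
    using hausdorff_cadlag_partition[OF T e D DT y] by blast
  \<comment> \<open>No jump at time 0: the start \<open>y 0\<close> already lies in
    \<open>D 0\<close>, and the limit must satisfy \<open>k 0 = 0\<close>.\<close>
  define B where "B = A - {0}"
  have B: "finite B" "B \<subseteq> {0<..<T}" using A by (force simp: B_def)+
  have "\<exists>d. \<forall>s\<in>B. y s + jump_fun B d s \<in> D s \<and> (\<forall>w\<in>D s. (y s + jump_fun B d s - w) \<bullet> d s \<le> 0)"
    by (rule discrete_solution_exists[OF B(1)]) (use B(2) b in force)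
  then obtain d where d: "\<forall>s\<in>B. y s + jump_fun B d s \<in> D s \<and> (\<forall>w\<in>D s. (y s + jump_fun B d s - w) \<bullet> d s \<le> 0)" ..
  have "infdist (y t + jump_fun B d t) (D t) \<le> e" if t: "t \<in> {0..T}" for t
  proof -
    obtain s where s: "s \<in> A" "s \<le> t" "A \<inter> {s<..t} = {}"
      "dist (y s) (y t) + hausdorff_dist (D s) (D t) \<le> e" using P t by blast
    have sT: "s \<in> {0..T}" using s t A by force
    have "B \<inter> {..0} = {}" using B by auto
    then have in_D: "y s + jump_fun B d s \<in> D s"
      using d y0 s by (cases "s = 0") (auto simp: B_def jump_fun_def)
    have eq: "jump_fun B d t = jump_fun B d s" by (rule jump_fun_eq) (use B s in \<open>auto simp: B_def\<close>)
    have "infdist (y t + jump_fun B d t) (D t) \<le>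
        infdist (y s + jump_fun B d s) (D t) + dist (y t + jump_fun B d t) (y s + jump_fun B d s)"
      by (rule infdist_triangle)
    also have "dist (y t + jump_fun B d t) (y s + jump_fun B d s) = dist (y s) (y t)"
      unfolding eq by (simp add: dist_commute)
    also have "infdist (y s + jump_fun B d s) (D t) \<le> hausdorff_dist (D s) (D t)"
      by (intro infdist_le_hausdorff_dist b in_D sT t)
    finally show ?thesis using s by linarith
  qed
  then show ?thesis
    using B d by (intro exI[of _ B] exI[of _ d] conjI ballI) simp_all
qed

section \<open>Uniform limits of jump functions\<close>

lemma tendsto_of_uniform_limit:
  fixes k :: "'b \<Rightarrow> 'a::banach"
  assumes lim: "\<And>n. (h n \<longlongrightarrow> l n) F" and close: "\<And>n s. norm (k s - h n s) \<le> \<eta> n"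
    and \<eta>: "\<eta> \<longlonglongrightarrow> (0::real)" and F: "F \<noteq> bot"
  obtains L where "l \<longlonglongrightarrow> L" "(k \<longlongrightarrow> L) F"
proof -
  have uni: "uniform_limit UNIV h k sequentially"
  proof (rule uniform_limitI)
    fix e :: real assume "e > 0"
    then have "\<forall>\<^sub>F n in sequentially. \<eta> n < e" using \<eta> by (intro order_tendstoD(2)) auto
    then show "\<forall>\<^sub>F n in sequentially. \<forall>x\<in>UNIV. dist (h n x) (k x) < e"
    proof eventually_elim
      case (elim n)
      then show ?case using close[of _ n] by (auto simp: dist_norm norm_minus_commute intro: le_less_trans)
    qed
  qed
  have l_dist: "norm (l m - l n) \<le> \<eta> m + \<eta> n" for m n
  proof (rule tendsto_upperbound[OF _ _ F])
    show "((\<lambda>s. norm (h m s - h n s)) \<longlongrightarrow> norm (l m - l n)) F" by (intro tendsto_norm tendsto_diff lim)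
    have "norm (h m s - h n s) \<le> \<eta> m + \<eta> n" for s
      using close[of s m] close[of s n] norm_triangle_ineq4[of "k s - h n s" "k s - h m s"] by simp
    then show "\<forall>\<^sub>F s in F. norm (h m s - h n s) \<le> \<eta> m + \<eta> n" by simp
  qed
  have "Cauchy l"
  proof (rule CauchyI)
    fix e :: real assume "e > 0"
    then have "\<forall>\<^sub>F n in sequentially. \<eta> n < e / 2" using \<eta> by (intro order_tendstoD(2)) auto
    then obtain M where M: "\<forall>n\<ge>M. \<eta> n < e / 2" unfolding eventually_sequentially ..
    have "norm (l m - l n) < e" if "m \<ge> M" "n \<ge> M" for m n
      using l_dist[of m n] M[rule_format, OF that(1)] M[rule_format, OF that(2)] by linarith
    then show "\<exists>M. \<forall>m\<ge>M. \<forall>n\<ge>M. norm (l m - l n) < e" by blast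
  qed
  then obtain L where L: "l \<longlonglongrightarrow> L" using Cauchy_convergent by (auto simp: convergent_def)
  have "(k \<longlongrightarrow> L) F"
    by (rule swap_uniform_limit'[OF _ L uni]) (use lim in auto)
  then show ?thesis using L that by blast
qed

lemma cadlag_uniform_limit_jump_fun:
  fixes k :: "real \<Rightarrow> 'a::banach"
  assumes A: "\<And>n. finite (A n)" "\<And>n. A n \<subseteq> {0<..<T}"
    and close: "\<And>n s. norm (k s - jump_fun (A n) (d n) s) \<le> \<eta> n" and \<eta>: "\<eta> \<longlonglongrightarrow> 0"
  shows "k \<in> cadlag_space T"
proof -
  have pt: "(\<lambda>n. jump_fun (A n) (d n) t) \<longlonglongrightarrow> k t" for t
    by (rule LIM_zero_cancel, rule Lim_null_comparison[OF _ \<eta>]) (use close in \<open>simp add: norm_minus_commute\<close>)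
  have "(k \<longlongrightarrow> k t) (at_right t)" for t
  proof -
    obtain L where "(\<lambda>n. jump_fun (A n) (d n) t) \<longlonglongrightarrow> L" "(k \<longlongrightarrow> L) (at_right t)"
      by (rule tendsto_of_uniform_limit[OF tendsto_jump_fun_right[OF A(1)] close \<eta>]) auto
    then show ?thesis using LIMSEQ_unique[OF pt] by blast
  qed
  moreover have "\<exists>l. (k \<longlongrightarrow> l) (at_left t)" for t
  proof -
    have "\<forall>n. \<exists>l. (jump_fun (A n) (d n) \<longlongrightarrow> l) (at_left t)" by (meson tendsto_jump_fun_left A(1))
    then obtain l where l: "\<And>n. (jump_fun (A n) (d n) \<longlongrightarrow> l n) (at_left t)" by metis
    obtain L where "(k \<longlongrightarrow> L) (at_left t)"
      by (rule tendsto_of_uniform_limit[OF l close \<eta>]) auto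
    then show ?thesis ..
  qed
  moreover have "(k \<longlongrightarrow> k T) (at_left T)"
  proof -
    have "(jump_fun (A n) (d n) \<longlongrightarrow> jump_fun (A n) (d n) T) (at_left T)" for n
    proof -
      \<comment> \<open>All jumps lie strictly before \<open>T\<close>, so the jump function is
        constant on a left neighbourhood of \<open>T\<close> including \<open>T\<close> itself; this
        gives the limit no jump at \<open>T\<close>.\<close>
      obtain u where u: "u < T" "A n \<inter> {u<..<T} = {}" using finite_gap_left[OF A(1)] .
      have "A n \<inter> {s<..T} = {}" if "u < s" for s using u(2) A(2)[of n] that by fastforce
      then have "\<forall>\<^sub>F s in at_left T. jump_fun (A n) (d n) s = jump_fun (A n) (d n) T"
        unfolding eventually_at_left[OF u(1)]
        by (intro exI[of _ u]) (use u A(1) in \<open>auto intro!: jump_fun_eq[symmetric]\<close>)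
      then show ?thesis by (rule tendsto_eventually)
    qed
    from tendsto_of_uniform_limit[OF this close \<eta>]
    obtain L where "(\<lambda>n. jump_fun (A n) (d n) T) \<longlonglongrightarrow> L" "(k \<longlongrightarrow> L) (at_left T)" by auto
    then show ?thesis using LIMSEQ_unique[OF pt] by blast
  qed
  ultimately show ?thesis by (simp add: cadlag_space_def cadlag_on_def)
qed

lemma uniform_cauchy_limit:
  fixes h :: "nat \<Rightarrow> 'b \<Rightarrow> 'a::banach"
  assumes "\<And>m n s. n \<le> m \<Longrightarrow> norm (h n s - h m s) \<le> \<eta> n" "\<eta> \<longlonglongrightarrow> (0::real)"
  obtains k where "\<And>n s. norm (k s - h n s) \<le> \<eta> n"
proof -
  have "\<exists>l. (\<lambda>n. h n s) \<longlonglongrightarrow> l" for s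
  proof -
    have "Cauchy (\<lambda>n. h n s)"
    proof (rule CauchyI')
      fix e :: real assume "e > 0"
      then have "\<forall>\<^sub>F n in sequentially. \<eta> n < e" using assms(2) by (intro order_tendstoD(2)) auto
      then obtain M where "\<forall>n\<ge>M. \<eta> n < e" unfolding eventually_sequentially ..
      then have "dist (h m s) (h n s) < e" if "m \<ge> M" "n > m" for m n
        using assms(1)[of m n s] that unfolding dist_norm by (meson le_less_trans less_imp_le)
      then show "\<exists>M. \<forall>m\<ge>M. \<forall>n>m. dist (h m s) (h n s) < e" by blast
    qed
    then show ?thesis using Cauchy_convergent by (auto simp: convergent_def)
  qed
  then obtain k where k: "\<And>s. (\<lambda>n. h n s) \<longlonglongrightarrow> k s" by metis
  have "norm (k s - h n s) \<le> \<eta> n" for n s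
  proof (rule LIMSEQ_le_const2)
    show "(\<lambda>m. norm (h m s - h n s)) \<longlonglongrightarrow> norm (k s - h n s)" by (intro tendsto_norm tendsto_diff k tendsto_const)
    show "\<exists>N. \<forall>m\<ge>N. norm (h m s - h n s) \<le> \<eta> n" using assms(1)[of n _ s] by (auto simp: norm_minus_commute)
  qed
  then show ?thesis by (rule that)
qed

lemma reflection_solution_exists:
  fixes y a :: "real \<Rightarrow> 'a::euclidean_space"
  assumes T: "0 < T" and D: "cadlag_bodies T D" and DT: "hausdorff_tendsto D (D T) (at_left T)"
    and y: "y \<in> cadlag_space T" and a: "a \<in> cadlag_space T" and y0: "y 0 \<in> D 0"
    and aD: "\<forall>t\<in>{0..T}. a t \<in> interior (D t)" and pos: "(INF t\<in>{0..T}. infdist (a t) (frontier (D t))) > 0"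
  shows "\<exists>x k. reflection_solution T D y x k"
proof -
  have conv: "D t \<in> convex_bodies" if "t \<in> {0..T}" for t using D that by (simp add: cadlag_bodies_def)
  note b = convex_bodiesD[OF conv]
  \<comment> \<open>Half of the infimum: the open ball of radius \<open>2 * r\<close> around
    \<open>a t\<close> lies in \<open>D t\<close>, hence so does the closed ball of radius
    \<open>r\<close>.\<close>
  define r where "r = (INF t\<in>{0..T}. infdist (a t) (frontier (D t))) / 2"
  have r0: "r > 0" using pos by (simp add: r_def)
  have cball: "w \<in> D t" if "t \<in> {0..T}" "dist (a t) w \<le> r" for w t
  proof -
    have "(INF t\<in>{0..T}. infdist (a t) (frontier (D t))) \<le> infdist (a t) (frontier (D t))"
      by (rule cINF_lower[OF _ that(1)]) (auto intro!: bdd_belowI[of _ 0] infdist_nonneg)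
    moreover have "a t \<in> D t" using aD that(1) interior_subset by blast
    ultimately have "ball (a t) (2 * r) \<subseteq> D t" by (intro ball_infdist_frontier_subset) (simp_all add: r_def)
    then show ?thesis using that r0 by auto
  qed
  have yc: "cadlag_on T y" and ac: "cadlag_on T a" using y a by (auto simp: cadlag_space_def)
  obtain V where V: "\<forall>A d. finite A \<longrightarrow> A \<subseteq> {0..T} \<longrightarrow>
    (\<forall>s\<in>A. r * norm (d s) \<le> ((a s - y s) - jump_fun A d s) \<bullet> d s) \<longrightarrow> (\<Sum>s\<in>A. norm (d s)) \<le> V"
    using discrete_variation_bound[OF T r0 cadlag_on_diff[OF ac yc]] by blast
  have V0: "0 \<le> V" using V[rule_format, of "{}"] by simp
  define e where "e n = inverse (real (Suc n))" for n
  have e0: "e n > 0" "n \<le> m \<Longrightarrow> e m \<le> e n" for n m by (auto simp: e_def intro!: le_imp_inverse_le)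
  have "\<forall>n. \<exists>A d. finite A \<and> A \<subseteq> {0<..<T} \<and>
    (\<forall>s\<in>A. \<forall>w\<in>D s. (y s + jump_fun A d s - w) \<bullet> d s \<le> 0) \<and>
    (\<forall>t\<in>{0..T}. infdist (y t + jump_fun A d t) (D t) \<le> e n)"
    using approximate_solution_exists[OF T e0(1) D DT y y0] by blast
  then obtain A d where A: "\<And>n. finite (A n)" "\<And>n. A n \<subseteq> {0<..<T}"
    and d: "\<And>n s w. s \<in> A n \<Longrightarrow> w \<in> D s \<Longrightarrow> (y s + jump_fun (A n) (d n) s - w) \<bullet> d n s \<le> 0"
    and dist: "\<And>n t. t \<in> {0..T} \<Longrightarrow> infdist (y t + jump_fun (A n) (d n) t) (D t) \<le> e n"
    by metis
  have AT: "s \<in> {0..T}" if "s \<in> A n" for s n using A(2)[of n] that by auto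
  have dV: "(\<Sum>s\<in>A n. norm (d n s)) \<le> V" for n
  proof (rule V[rule_format, OF A(1)])
    show "A n \<subseteq> {0..T}" using AT by auto
    fix s assume s: "s \<in> A n"
    show "r * norm (d n s) \<le> (a s - y s - jump_fun (A n) (d n) s) \<bullet> d n s"
    proof (cases "d n s = 0")
      case False
      \<comment> \<open>The point of the closed ball around \<open>a s\<close> farthest in the
        direction opposite to the jump; testing with it produces the term
        \<open>r * norm (d n s)\<close>.\<close>
      define w where "w = a s - (r / norm (d n s)) *\<^sub>R d n s"
      have "w \<in> D s" using False r0 AT[OF s] by (intro cball) (auto simp: w_def dist_norm)
      from d[OF s this] show ?thesis using False
        by (simp add: w_def inner_diff_left inner_add_left power2_norm_eq_inner[symmetric] power2_eq_square)
    qed simp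
  qed
  \<comment> \<open>For n <= m the stability bound 2 (e n + e m) V is at most 4 V e n, since
    \<open>e\<close> decreases.\<close>
  define \<eta> where "\<eta> n = sqrt (4 * V * e n)" for n
  have "e \<longlonglongrightarrow> 0" unfolding e_def by (rule LIMSEQ_inverse_real_of_nat)
  then have "\<eta> \<longlonglongrightarrow> sqrt (4 * V * 0)" unfolding \<eta>_def[abs_def] by (intro tendsto_intros)
  then have \<eta>: "\<eta> \<longlonglongrightarrow> 0" by simp
  have "norm (jump_fun (A n) (d n) s - jump_fun (A m) (d m) s) \<le> \<eta> n" if "n \<le> m" for m n s
  proof -
    have "(norm (jump_fun (A n) (d n) s - jump_fun (A m) (d m) s))\<^sup>2 \<le> 2 * (e n + e m) * V"
      by (rule discrete_stability[where D = D and y = y])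
        (use A d dist dV AT e0 b in \<open>auto intro: less_imp_le\<close>)
    also have "\<dots> \<le> 2 * (e n + e n) * V" using e0(2)[OF that] V0 by (intro mult_right_mono mult_left_mono) auto
    finally show ?thesis unfolding \<eta>_def by (intro real_le_rsqrt) (simp add: algebra_simps)
  qed
  then obtain k where close: "\<And>n s. norm (k s - jump_fun (A n) (d n) s) \<le> \<eta> n"
    using uniform_cauchy_limit[OF _ \<eta>, of "\<lambda>n. jump_fun (A n) (d n)"] by blast
  have pt: "(\<lambda>n. jump_fun (A n) (d n) t) \<longlonglongrightarrow> k t" for t
    by (rule LIM_zero_cancel, rule Lim_null_comparison[OF _ \<eta>]) (use close in \<open>simp add: norm_minus_commute\<close>)
  define x where "x t = y t + k t" for t
  have kc: "k \<in> cadlag_space T" by (rule cadlag_uniform_limit_jump_fun[OF A close \<eta>])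
  have kc': "cadlag_on T k" using kc by (simp add: cadlag_space_def)
  have xc: "x \<in> cadlag_space T"
    using cadlag_on_add[OF yc kc'] tendsto_add y kc unfolding cadlag_space_def x_def by blast
  have xc': "cadlag_on T x" using xc by (simp add: cadlag_space_def)
  have k_var: "v \<le> V" if t: "t \<in> {0..T}" and v: "v \<in> variation_sums k t" for t v
  proof -
    obtain p n where p: "v = (\<Sum>i<n. norm (k (p (Suc i)) - k (p i)))" "p 0 = 0" "p n = t" "\<forall>i<n. p i \<le> p (Suc i)"
      using v by (auto simp: variation_sums_def)
    show ?thesis unfolding p(1)
    \<comment> \<open>Lower semicontinuity of the variation: for a fixed partition the sum of
      \<open>k\<close> is the limit of the sums of the schemes, all at most
      \<open>V\<close>.\<close>
    proof (rule LIMSEQ_le_const2)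
      show "(\<lambda>m. \<Sum>i<n. norm (jump_fun (A m) (d m) (p (Suc i)) - jump_fun (A m) (d m) (p i))) \<longlonglongrightarrow>
          (\<Sum>i<n. norm (k (p (Suc i)) - k (p i)))" by (intro tendsto_intros pt)
      have "(\<Sum>i<n. norm (jump_fun (A m) (d m) (p (Suc i)) - jump_fun (A m) (d m) (p i))) \<le> V" for m
        by (rule order_trans[OF variation_sums_jump_fun_le[OF A(1), of t] dV])
          (use t p in \<open>auto simp: variation_sums_def\<close>)
      then show "\<exists>N. \<forall>m\<ge>N. (\<Sum>i<n. norm (jump_fun (A m) (d m) (p (Suc i)) - jump_fun (A m) (d m) (p i))) \<le> V" by blast
    qed
  qed
  have fv: "finite_variation T k" unfolding finite_variation_def using k_var[of T] T by (intro bdd_aboveI) auto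
  have "A n \<inter> {..0} = {}" for n using A(2)[of n] by auto
  then have k0: "k 0 = 0" using LIMSEQ_unique[OF pt[of 0], of 0] by (simp add: jump_fun_def)
  have xD: "x t \<in> D t" if t: "t \<in> {0..T}" for t
  proof -
    have "infdist (x t) (D t) \<le> e n + \<eta> n" for n
      using infdist_triangle[of "x t" "D t" "y t + jump_fun (A n) (d n) t"] dist[OF t, of n] close[of t n]
      by (simp add: x_def dist_norm)
    moreover have "(\<lambda>n. e n + \<eta> n) \<longlonglongrightarrow> 0 + 0" by (intro tendsto_add \<open>e \<longlonglongrightarrow> 0\<close> \<eta>)
    ultimately have "infdist (x t) (D t) \<le> 0 + 0" by (intro LIMSEQ_le_const) auto
    then show ?thesis using b(2,4)[OF t] in_closed_iff_infdist_zero infdist_nonneg[of "x t" "D t"] by force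
  qed
  have "LS_inner_integral t (\<lambda>s. x s - z s) k \<le> 0"
    if z: "cadlag_on T z" "\<forall>t\<in>{0..T}. z t \<in> D t" and t: "t \<in> {0..T}" for z t
  proof (rule integral_limit_nonpos[OF T t cadlag_on_diff[OF xc' z(1)] V0 k_var[OF t] A(1) dV close \<eta>])
    show "right_sum t (\<lambda>s. x s - z s) k \<longlonglongrightarrow> LS_inner_integral t (\<lambda>s. x s - z s) k"
      using t by (intro right_sum_tendsto_LS_inner_integral[OF T] fv kc' cadlag_on_diff xc' z) auto
    fix n
    have \<eta>0: "0 \<le> \<eta> n" using order_trans[OF norm_ge_zero close] .
    have "(\<Sum>s\<in>A n \<inter> {0<..t}. (x s - z s) \<bullet> d n s) \<le> (\<Sum>s\<in>A n \<inter> {0<..t}. \<eta> n * norm (d n s))"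
    proof (rule sum_mono)
      fix s assume s: "s \<in> A n \<inter> {0<..t}"
      \<comment> \<open>At a time of the scheme, \<open>x\<close> differs from the scheme's position
        by at most \<open>\<eta> n\<close>, and that position satisfies the inequality for
        \<open>z s\<close> exactly.\<close>
      have "(x s - z s) \<bullet> d n s = (y s + jump_fun (A n) (d n) s - z s) \<bullet> d n s +
          (k s - jump_fun (A n) (d n) s) \<bullet> d n s" by (simp add: x_def algebra_simps)
      also have "\<dots> \<le> 0 + \<eta> n * norm (d n s)"
      proof (rule add_mono)
        show "(y s + jump_fun (A n) (d n) s - z s) \<bullet> d n s \<le> 0" using s z(2) AT by (intro d) auto
        show "(k s - jump_fun (A n) (d n) s) \<bullet> d n s \<le> \<eta> n * norm (d n s)"
          by (intro order_trans[OF norm_cauchy_schwarz] mult_right_mono close) auto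
      qed
      finally show "(x s - z s) \<bullet> d n s \<le> \<eta> n * norm (d n s)" by simp
    qed
    also have "\<dots> \<le> (\<Sum>s\<in>A n. \<eta> n * norm (d n s))" using A(1) \<eta>0 by (intro sum_mono2) auto
    also have "\<dots> \<le> \<eta> n * V" unfolding sum_distrib_left[symmetric] by (intro mult_left_mono dV \<eta>0)
    finally show "(\<Sum>s\<in>A n \<inter> {0<..t}. (x s - z s) \<bullet> d n s) \<le> \<eta> n * V" .
  qed
  then have "reflection_solution T D y x k"
    unfolding reflection_solution_def using xc kc fv k0 xD by (auto simp: x_def)
  then show ?thesis by blast
qed

lemma SUP_norm_sq_nonneg:
  fixes f :: "real \<Rightarrow> 'a::real_normed_vector"
  assumes "0 < T" "cadlag_on T f"
  shows "0 \<le> (SUP s\<in>{0..T}. (norm (f s))\<^sup>2)"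
proof -
  obtain M where M: "\<And>t. t \<in> {0..T} \<Longrightarrow> norm (f t) \<le> M" using cadlag_bounded[OF assms] by blast
  have "bdd_above ((\<lambda>s. (norm (f s))\<^sup>2) ` {0..T})"
    by (rule bdd_aboveI2[of _ _ "M\<^sup>2"]) (intro power_mono M norm_ge_zero)
  then have "(norm (f 0))\<^sup>2 \<le> (SUP s\<in>{0..T}. (norm (f s))\<^sup>2)" using assms(1) by (intro cSUP_upper) auto
  then show ?thesis using zero_le_power2 order_trans by blast
qed

theorem theorem2p1:
  fixes T :: real
    and D :: "real \<Rightarrow> (real ^ 'd) set"
    and y a :: "real \<Rightarrow> real ^ 'd"
  assumes "T > 0"
    and "cadlag_bodies T D"
    and "hausdorff_tendsto D (D T) (at_left T)"
    and "y \<in> cadlag_space T"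
    and "a \<in> cadlag_space T"
    and "y 0 \<in> D 0"
    and "\<forall>t\<in>{0..T}. a t \<in> interior (D t)"
    and "(INF t\<in>{0..T}. infdist (a t) (frontier (D t))) > 0"
  shows "\<exists>x k. reflection_solution T D y x k \<and>
           (\<forall>x' k'. reflection_solution T D y x' k' \<longrightarrow>
              (\<forall>t\<in>{0..T}. x' t = x t \<and> k' t = k t)) \<and>
           (\<exists>C>0. total_variation k T \<le>
              C * ((SUP s\<in>{0..T}. (norm (y s))\<^sup>2) + (SUP s\<in>{0..T}. (norm (a s))\<^sup>2) + 1))"
proof -
  obtain x k where sol: "reflection_solution T D y x k"
    using reflection_solution_exists[OF assms] by blast
  define S where "S = (SUP s\<in>{0..T}. (norm (y s))\<^sup>2) + (SUP s\<in>{0..T}. (norm (a s))\<^sup>2)"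
  have "0 \<le> S"
    unfolding S_def using assms by (intro add_nonneg_nonneg SUP_norm_sq_nonneg) (auto simp: cadlag_space_def)
  then have "max 1 (total_variation k T) * 1 \<le> max 1 (total_variation k T) * (S + 1)"
    by (intro mult_left_mono) auto
  then have "total_variation k T \<le> max 1 (total_variation k T) * (S + 1)" by linarith
  \<comment> \<open>\<open>C\<close> may depend on all the data, so it is enough that \<open>k\<close> has finite variation.\<close>
  then have "\<exists>C>0. total_variation k T \<le> C * (S + 1)"
    by (intro exI[of _ "max 1 (total_variation k T)"]) auto
  then show ?thesis
    using sol reflection_solution_unique[OF assms(1) _ sol] unfolding S_def by blast
qed

end
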